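(* The homogeneous nearly Kähler $\mathbb{S}^3\times\mathbb{S}^3$ does not admit a hypersurface $M$ whose shape operator $A$ and induced almost contact structure tensor $\phi$ satisfy $A\phi+\phi A=0$ on $M$.
   Context: The homogeneous nearly Kähler $\mathbb{S}^3\times\mathbb{S}^3$: regard $\mathbb{S}^3$ as the set of unit quaternions in the quaternion space $\mathbb{H}$. Using $T_{(p,q)}(\mathbb{S}^3\times\mathbb{S}^3)\cong T_p\mathbb{S}^3\oplus T_q\mathbb{S}^3$, write a tangent vector at $(p,q)$ as $Z=(V,W)$ with $V\in T_p\mathbb{S}^3$, $W\in T_q\mathbb{S}^3$ (regarded as quaternions). The almost complex structure is $$JZ=\tfrac{1}{\sqrt3}\,(2pq^{-1}W-V,\,-2qp^{-1}V+W),$$ and the Hermitian metric is $$g(Z,Z')=\tfrac12\big(\langle Z,Z'\rangle+\langle JZ,JZ'\rangle\big),$$ where $\langle\cdot,\cdot\rangle$ is the standard product metric on $\mathbb{S}^3\times\mathbb{S}^3$. Let $\tilde\nabla$ be the Levi-Civita connection of $g$. Hypersurfaces: a hypersurface $M$ is a smooth (nonempty) immersed submanifold of real dimension $5$ with the induced metric, also denoted $g$. Let $\xi$ be a (local) unit normal vector field along $M$. The shape operator $A$ is the $(1,1)$-tensor field on $M$ defined by taking $-AX=\tilde\nabla_X\xi$ for $X$ tangent to $M$. The tensor field $\phi$ of type $(1,1)$ is defined by letting $\phi X$ be the tangential part of $JX$, i.e. $JX=\phi X+f(X)\xi$ with $\phi X$ tangent to $M$ and $f$ a $1$-form on $M$.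 Replacing $\xi$ by $-\xi$ leaves $\phi$ unchanged and changes the sign of $A$, so the condition $A\phi+\phi A=0$ does not depend on the choice of $\xi$. *)

theory Defs
  imports "HOL-Analysis.Analysis"
begin

section \<open>Smooth maps\<close>

primrec k_smooth_on :: "nat \<Rightarrow> 'a::real_normed_vector set \<Rightarrow> ('a \<Rightarrow> 'b::real_normed_vector) \<Rightarrow> bool"
  where
    "k_smooth_on 0 S f \<longleftrightarrow> continuous_on S f"
  | "k_smooth_on (Suc k) S f \<longleftrightarrow>
       (\<forall>x\<in>S. f differentiable (at x)) \<and>
       (\<forall>v. k_smooth_on k S (\<lambda>x. frechet_derivative f (at x) v))"

text \<open>Meant for open \<open>S\<close>: smoothness of class C-infinity.\<close>

definition smooth_on :: "'a::real_normed_vector set \<Rightarrow> ('a \<Rightarrow> 'b::real_normed_vector) \<Rightarrow> bool"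
  where "smooth_on S f \<longleftrightarrow> (\<forall>k. k_smooth_on k S f)"

text \<open>Smoothness on an arbitrary subset: near each point the map is the restriction of
  a smooth map defined on an open set of the ambient space.\<close>

definition smooth_on_subset :: "'a::real_normed_vector set \<Rightarrow> ('a \<Rightarrow> 'b::real_normed_vector) \<Rightarrow> bool"
  where "smooth_on_subset S f \<longleftrightarrow>
    (\<forall>x\<in>S. \<exists>U h. open U \<and> x \<in> U \<and> smooth_on U h \<and> (\<forall>y\<in>U \<inter> S. h y = f y))"


section \<open>Quaternions and the almost Hermitian structure\<close>

text \<open>\<open>(a, u)\<close> stands for \<open>a + u\<^sub>1 i + u\<^sub>2 j + u\<^sub>3 k\<close>; norm and inner product of the product
  type are the Euclidean ones.\<close>

type_synonym quat = "real \<times> (real^3)"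

definition qmult :: "quat \<Rightarrow> quat \<Rightarrow> quat"  (infixl \<open>\<odot>\<close> 75)
  where "x \<odot> y = (fst x * fst y - snd x \<bullet> snd y,
                  fst x *\<^sub>R snd y + fst y *\<^sub>R snd x + cross3 (snd x) (snd y))"

definition qinv :: "quat \<Rightarrow> quat"
  where "qinv x = (1 / (norm x)\<^sup>2) *\<^sub>R (fst x, - snd x)"

type_synonym quat2 = "quat \<times> quat"

definition S3S3 :: "quat2 set"
  where "S3S3 = {(p, q). norm p = 1 \<and> norm q = 1}"

definition tangent_S3S3 :: "quat2 \<Rightarrow> quat2 set"
  where "tangent_S3S3 x = {(V, W). V \<bullet> fst x = 0 \<and> W \<bullet> snd x = 0}"

definition J :: "quat2 \<Rightarrow> quat2 \<Rightarrow> quat2"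
  where "J x Z = (1 / sqrt 3) *\<^sub>R
    (2 *\<^sub>R (fst x \<odot> qinv (snd x) \<odot> snd Z) - fst Z,
     (-2) *\<^sub>R (snd x \<odot> qinv (fst x) \<odot> fst Z) + snd Z)"

definition g :: "quat2 \<Rightarrow> quat2 \<Rightarrow> quat2 \<Rightarrow> real"
  where "g x Z Z' = (1/2) * (Z \<bullet> Z' + J x Z \<bullet> J x Z')"


section \<open>Vector fields and the Levi-Civita connection of \<open>g\<close>\<close>

text \<open>Vector fields are total functions of which only the values on \<open>S3S3\<close> matter.\<close>

definition vector_field :: "(quat2 \<Rightarrow> quat2) \<Rightarrow> bool"
  where "vector_field X \<longleftrightarrow> smooth_on_subset S3S3 X \<and> (\<forall>x\<in>S3S3. X x \<in> tangent_S3S3 x)"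

text \<open>The Frechet derivative within \<open>S3S3\<close> is determined only on vectors tangent to \<open>S3S3\<close>, so this
  is meaningful for \<open>v \<in> tangent_S3S3 x\<close>; there it is the derivative of \<open>f\<close> along any curve in
  \<open>S3S3\<close> through \<open>x\<close> with velocity \<open>v\<close>.\<close>

definition dir_deriv :: "(quat2 \<Rightarrow> 'b::real_normed_vector) \<Rightarrow> quat2 \<Rightarrow> quat2 \<Rightarrow> 'b"
  where "dir_deriv f x v = frechet_derivative f (at x within S3S3) v"

text \<open>For fields tangent to a submanifold of a vector space, the ambient expression of the bracket
  is tangent again and is the intrinsic Lie bracket.\<close>

definition lie_bracket :: "(quat2 \<Rightarrow> quat2) \<Rightarrow> (quat2 \<Rightarrow> quat2) \<Rightarrow> quat2 \<Rightarrow> quat2"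
  where "lie_bracket X Y x = dir_deriv Y x (X x) - dir_deriv X x (Y x)"

definition affine_connection :: "((quat2 \<Rightarrow> quat2) \<Rightarrow> (quat2 \<Rightarrow> quat2) \<Rightarrow> quat2 \<Rightarrow> quat2) \<Rightarrow> bool"
  where "affine_connection nabla \<longleftrightarrow>
    (\<forall>X Y. vector_field X \<longrightarrow> vector_field Y \<longrightarrow> vector_field (nabla X Y)) \<and>
    (\<forall>X X' Y. vector_field X \<longrightarrow> vector_field X' \<longrightarrow> vector_field Y \<longrightarrow>
      (\<forall>x\<in>S3S3. nabla (\<lambda>y. X y + X' y) Y x = nabla X Y x + nabla X' Y x)) \<and>
    (\<forall>f X Y. smooth_on_subset S3S3 f \<longrightarrow> vector_field X \<longrightarrow> vector_field Y \<longrightarrow>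
      (\<forall>x\<in>S3S3. nabla (\<lambda>y. f y *\<^sub>R X y) Y x = f x *\<^sub>R nabla X Y x)) \<and>
    (\<forall>X Y Y'. vector_field X \<longrightarrow> vector_field Y \<longrightarrow> vector_field Y' \<longrightarrow>
      (\<forall>x\<in>S3S3. nabla X (\<lambda>y. Y y + Y' y) x = nabla X Y x + nabla X Y' x)) \<and>
    (\<forall>f X Y. smooth_on_subset S3S3 f \<longrightarrow> vector_field X \<longrightarrow> vector_field Y \<longrightarrow>
      (\<forall>x\<in>S3S3. nabla X (\<lambda>y. f y *\<^sub>R Y y) x = dir_deriv f x (X x) *\<^sub>R Y x + f x *\<^sub>R nabla X Y x))"

definition levi_civita :: "((quat2 \<Rightarrow> quat2) \<Rightarrow> (quat2 \<Rightarrow> quat2) \<Rightarrow> quat2 \<Rightarrow> quat2) \<Rightarrow> bool"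
  where "levi_civita nabla \<longleftrightarrow>
    affine_connection nabla \<and>
    (\<forall>X Y. vector_field X \<longrightarrow> vector_field Y \<longrightarrow>
      (\<forall>x\<in>S3S3. nabla X Y x - nabla Y X x = lie_bracket X Y x)) \<and>
    (\<forall>X Y Z. vector_field X \<longrightarrow> vector_field Y \<longrightarrow> vector_field Z \<longrightarrow>
      (\<forall>x\<in>S3S3. dir_deriv (\<lambda>y. g y (Y y) (Z y)) x (X x)
                   = g x (nabla X Y x) (Z x) + g x (Y x) (nabla X Z x)))"


section \<open>Smooth manifolds and immersed hypersurfaces\<close>

text \<open>A chart is a pair of its domain and its coordinate map; the model space, and with it the
  dimension, is given by the type \<open>'e\<close>.\<close>

type_synonym ('m, 'e) chart = "'m set \<times> ('m \<Rightarrow> 'e)"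

definition smooth_manifold :: "'m topology \<Rightarrow> ('m, 'e::euclidean_space) chart set \<Rightarrow> bool"
  where "smooth_manifold M \<A> \<longleftrightarrow>
    Hausdorff_space M \<and> second_countable M \<and>
    (\<Union>(U, c)\<in>\<A>. U) = topspace M \<and>
    (\<forall>(U, c)\<in>\<A>. openin M U \<and> open (c ` U) \<and>
        homeomorphic_map (subtopology M U) (top_of_set (c ` U)) c) \<and>
    (\<forall>(U, c)\<in>\<A>. \<forall>(V, d)\<in>\<A>. smooth_on (c ` (U \<inter> V)) (d \<circ> inv_into U c))"

definition smooth_map_on ::
  "('m, 'e::euclidean_space) chart set \<Rightarrow> 'm set \<Rightarrow> ('m \<Rightarrow> 'b::real_normed_vector) \<Rightarrow> bool"
  where "smooth_map_on \<A> V f \<longleftrightarrow> (\<forall>(U, c)\<in>\<A>. smooth_on (c ` (U \<inter> V)) (f \<circ> inv_into U c))"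

text \<open>The dimension 5 is that of the model space. \<open>F\<close> need not be injective.\<close>

definition immersed_hypersurface ::
  "'m topology \<Rightarrow> ('m, real^5) chart set \<Rightarrow> ('m \<Rightarrow> quat2) \<Rightarrow> bool"
  where "immersed_hypersurface M \<A> F \<longleftrightarrow>
    smooth_manifold M \<A> \<and> topspace M \<noteq> {} \<and>
    (\<forall>x\<in>topspace M. F x \<in> S3S3) \<and>
    smooth_map_on \<A> (topspace M) F \<and>
    (\<forall>(U, c)\<in>\<A>. \<forall>x\<in>U. inj (frechet_derivative (F \<circ> inv_into U c) (at (c x))))"

text \<open>The tangent space of the hypersurface at \<open>x\<close>, identified through the differential of \<open>F\<close>
  with a subspace of \<open>tangent_S3S3 (F x)\<close>. All charts around \<open>x\<close> contribute the same subspace.\<close>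

definition tangent_hyp ::
  "('m, real^5) chart set \<Rightarrow> ('m \<Rightarrow> quat2) \<Rightarrow> 'm \<Rightarrow> quat2 set"
  where "tangent_hyp \<A> F x =
    (\<Union>(U, c)\<in>{(U, c)\<in>\<A>. x \<in> U}. range (frechet_derivative (F \<circ> inv_into U c) (at (c x))))"

definition unit_normal_on ::
  "('m, real^5) chart set \<Rightarrow> ('m \<Rightarrow> quat2) \<Rightarrow> 'm set \<Rightarrow> ('m \<Rightarrow> quat2) \<Rightarrow> bool"
  where "unit_normal_on \<A> F V \<xi> \<longleftrightarrow>
    smooth_map_on \<A> V \<xi> \<and>
    (\<forall>x\<in>V. \<xi> x \<in> tangent_S3S3 (F x) \<and> g (F x) (\<xi> x) (\<xi> x) = 1 \<and>
            (\<forall>w\<in>tangent_hyp \<A> F x. g (F x) (\<xi> x) w = 0))"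

text \<open>\<open>z\<close> is the covariant derivative at \<open>x\<close>, in the direction \<open>w\<close>, of the field \<open>\<zeta>\<close> along \<open>F\<close>: as usual,
  \<open>w\<close> and (near \<open>x\<close>) \<open>\<zeta>\<close> are extended to vector fields on the ambient manifold. The vector \<open>z\<close> does
  not depend on the extensions, and for smooth \<open>\<zeta>\<close> they exist because an immersion is
  locally an embedding.\<close>

definition covariant_deriv_along ::
  "((quat2 \<Rightarrow> quat2) \<Rightarrow> (quat2 \<Rightarrow> quat2) \<Rightarrow> quat2 \<Rightarrow> quat2) \<Rightarrow> 'm topology \<Rightarrow> ('m \<Rightarrow> quat2) \<Rightarrow>
    ('m \<Rightarrow> quat2) \<Rightarrow> 'm \<Rightarrow> quat2 \<Rightarrow> quat2 \<Rightarrow> bool"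
  where "covariant_deriv_along nabla M F \<zeta> x w z \<longleftrightarrow>
    (\<exists>X Y U. vector_field X \<and> vector_field Y \<and> X (F x) = w \<and>
       openin M U \<and> x \<in> U \<and> (\<forall>y\<in>U. Y (F y) = \<zeta> y) \<and>
       z = nabla X Y (F x))"

definition shape_operator_on ::
  "((quat2 \<Rightarrow> quat2) \<Rightarrow> (quat2 \<Rightarrow> quat2) \<Rightarrow> quat2 \<Rightarrow> quat2) \<Rightarrow> 'm topology \<Rightarrow> ('m, real^5) chart set \<Rightarrow>
    ('m \<Rightarrow> quat2) \<Rightarrow> 'm set \<Rightarrow> ('m \<Rightarrow> quat2) \<Rightarrow> ('m \<Rightarrow> quat2 \<Rightarrow> quat2) \<Rightarrow> bool"
  where "shape_operator_on nabla M \<A> F V \<xi> A \<longleftrightarrow>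
    (\<forall>x\<in>V. \<forall>w\<in>tangent_hyp \<A> F x.
       A x w \<in> tangent_hyp \<A> F x \<and> covariant_deriv_along nabla M F \<xi> x w (- A x w))"

definition phi ::
  "('m, real^5) chart set \<Rightarrow> ('m \<Rightarrow> quat2) \<Rightarrow> ('m \<Rightarrow> quat2) \<Rightarrow> 'm \<Rightarrow> quat2 \<Rightarrow> quat2"
  where "phi \<A> F \<xi> x w =
    (THE t. t \<in> tangent_hyp \<A> F x \<and> (\<exists>a. J (F x) w = t + a *\<^sub>R \<xi> x))"

end

theory Submission
  imports Defs
begin

text \<open>
  \<open>S3 \<times> S3\<close> is a Lie group with left-invariant metric and almost complex structure, so everything
  is expressed in a left-invariant frame: a tangent vector becomes a pair \<open>(x, y)\<close> of vectors of
  \<open>\<real>\<^sup>3\<close>. The frame \<open>frame\<close> is chosen such that \<open>g\<close> is 12 times the standard inner product, \<open>J\<close> is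
  \<open>(x, y) \<mapsto> (-y, x)\<close>, and the Lie bracket and the Levi-Civita connection have rational constant
  coefficients built from cross products (\<open>frame_frame\<close>, \<open>levi_civita_coords\<close>). A
  hypersurface is, in a chart, an immersion with coframe \<open>\<omega>\<close> (the differential read in the frame) and a
  unit vector \<open>n = (u, w)\<close>, with \<open>dn + \<Gamma>(\<omega>, n) = - S \<omega>\<close> for the (rescaled) shape operator \<open>S\<close>.
  The locale \<open>anticommuting_patch\<close> collects these data, and it is shown to have empty domain.

  If \<open>S\<close> anticommutes with \<open>\<phi>\<close>, then \<open>Jn\<close> is an eigenvector of \<open>S\<close>, and \<open>S J = - J S\<close> on the
  complex subspace \<open>D\<close> orthogonal to \<open>n\<close> and \<open>Jn\<close>. Hence the form \<open>\<theta> = \<langle>\<nabla>n, Jn\<rangle>\<close> is a multiple of the contact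
  form \<open>\<eta> = \<langle>\<omega>, Jn\<rangle>\<close>. Differentiating \<open>\<theta> \<and> \<eta> = 0\<close> and evaluating on \<open>(X, JX, Jn)\<close> with \<open>X\<close> in \<open>D\<close> is the
  Codazzi equation paired with \<open>Jn\<close>. The eigenvalue drops out, and what remains is a perfect square,
  \<open>|S X + J G(X, n) / 2|\<^sup>2 = 4 (\<langle>X, Pn\<rangle>\<^sup>2 + \<langle>X, JPn\<rangle>\<^sup>2)\<close>  (\<open>key_identity\<close>), where \<open>G = (\<nabla>J)\<close> and \<open>P(x, y) = (x, -y)\<close>
  is the almost product structure.

  On vectors of \<open>D\<close> orthogonal to \<open>Pn\<close> and \<open>JPn\<close> this determines \<open>S\<close>. Because \<open>S\<close> is symmetric while
  \<open>X \<mapsto> J G(X, n)\<close> is skew, the identity at the image of such a vector, together with the Cauchy-Schwarz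
  inequality, leaves only the extremal case \<open>|u| = |w|\<close>, \<open>u \<bottom> w\<close> (\<open>normal_form\<close>). So \<open>u\<close>, \<open>w\<close> and \<open>k = u \<times> w\<close>
  form an orthogonal moving frame of \<open>\<real>\<^sup>3\<close>, and the known part of \<open>S\<close> yields \<open>\<eta> = - \<langle>du, k\<rangle>\<close>. The
  exterior derivative of this equation on the vectors \<open>(k, 0)\<close> and \<open>(u, -w)\<close> is \<open>-2\<close> by the
  Maurer-Cartan equation for \<open>\<omega>\<close>, but \<open>-4\<close> because \<open>d(du) = 0\<close>: a contradiction (\<open>empty_domain\<close>).
\<close>

section \<open>Constant tensors in frame coordinates\<close>

type_synonym frame_coords = "(real^3) \<times> (real^3)"

definition Jc :: "frame_coords \<Rightarrow> frame_coords"
  where "Jc X = (- snd X, fst X)"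

text \<open>The Lie algebra of the group \<open>S3 \<times> S3\<close> in the coordinates of the left-invariant frame below.\<close>

definition bracket :: "frame_coords \<Rightarrow> frame_coords \<Rightarrow> frame_coords"
  where "bracket X Y = (6 *\<^sub>R cross3 (fst X) (fst Y) + 2 *\<^sub>R cross3 (snd X) (snd Y),
                    6 *\<^sub>R (cross3 (fst X) (snd Y) + cross3 (snd X) (fst Y)))"

text \<open>The coefficients of the Levi-Civita connection on constant combinations of the frame.\<close>

definition christoffel :: "frame_coords \<Rightarrow> frame_coords \<Rightarrow> frame_coords"
  where "christoffel X Y = (3 *\<^sub>R cross3 (fst X) (fst Y) + cross3 (snd X) (snd Y),
                    5 *\<^sub>R cross3 (fst X) (snd Y) + cross3 (snd X) (fst Y))"

text \<open>This is \<open>X \<mapsto> J G(X, n)\<close>, where \<open>G(X, n) = christoffel X (Jc n) - Jc (christoffel X n)\<close> is the covariant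
  derivative of the almost complex structure.\<close>

definition JG :: "frame_coords \<Rightarrow> frame_coords \<Rightarrow> frame_coords"
  where "JG n X = 2 *\<^sub>R (cross3 (snd X) (snd n) - cross3 (fst X) (fst n),
                        cross3 (fst X) (snd n) + cross3 (snd X) (fst n))"

text \<open>The almost product structure of the nearly Kaehler \<open>S3 \<times> S3\<close>.\<close>

definition Pc :: "frame_coords \<Rightarrow> frame_coords"
  where "Pc X = (fst X, - snd X)"

lemmas coord_defs = Jc_def bracket_def christoffel_def JG_def Pc_def inner_prod_def cross3_def inner_vec_def sum_3

lemma inner_Jc_Jc [simp]: "Jc X \<bullet> Jc Y = X \<bullet> Y"
  by (simp add: Jc_def inner_prod_def)

lemma inner_Jc_left: "Jc X \<bullet> Y = - (X \<bullet> Jc Y)"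
  by (simp add: Jc_def inner_prod_def)

lemma Jc_Jc [simp]: "Jc (Jc X) = - X"
  by (simp add: Jc_def prod_eq_iff)

lemma linear_Jc: "linear Jc"
  by (rule linearI) (simp_all add: Jc_def)

lemma bounded_linear_Jc [bounded_linear]: "bounded_linear Jc"
  by (simp add: linear_Jc linear_conv_bounded_linear[symmetric])

lemma bilinear_christoffel: "bilinear christoffel"
  unfolding bilinear_def
  by (intro conjI allI linearI)
     (simp_all add: christoffel_def prod_eq_iff cross_add_left cross_add_right cross_mult_left cross_mult_right
       scaleR_add_right)

lemma christoffel_skew: "christoffel X Y \<bullet> Z = - (Y \<bullet> christoffel X Z)"
  by (simp add: coord_defs algebra_simps)

lemma bracket_christoffel: "bracket X Y = christoffel X Y - christoffel Y X"
  by (simp add: coord_defs prod_eq_iff vec_eq_iff forall_3 algebra_simps)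

text \<open>The Koszul formula for fields with constant coefficients, for which the inner products are
  constant and only the brackets remain.\<close>

lemma christoffel_koszul: "2 * (christoffel X Y \<bullet> Z) = bracket X Y \<bullet> Z - Y \<bullet> bracket X Z - X \<bullet> bracket Y Z"
  by (simp add: coord_defs algebra_simps)

text \<open>The left-hand side is the curvature component \<open>\<langle>R(X, JX) n, Jn\<rangle>\<close>. The two terms with \<open>X \<bullet> n\<close> and \<open>X \<bullet> Jc n\<close>
  make this a polynomial identity, valid for all \<open>X\<close> and \<open>n\<close>.\<close>

lemma curvature_identity:
  "(christoffel X (christoffel (Jc X) n) - christoffel (Jc X) (christoffel X n) - christoffel (bracket X (Jc X)) n) \<bullet> Jc n
    = 8 * ((X \<bullet> Pc n)\<^sup>2 + (X \<bullet> Jc (Pc n))\<^sup>2) - 2 * (X \<bullet> X) * (n \<bullet> n) - 6 * (X \<bullet> n)\<^sup>2 - 6 * (X \<bullet> Jc n)\<^sup>2"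
  by (simp add: coord_defs, simp add: power2_eq_square) algebra

text \<open>The nearly Kaehler structure is of constant type: on unit vectors \<open>X\<close> orthogonal to \<open>n\<close> and \<open>Jn\<close> the
  length of \<open>G(X, n)\<close> is constant.\<close>

lemma JG_norm: "JG n X \<bullet> JG n X = 4 * ((X \<bullet> X) * (n \<bullet> n) - (X \<bullet> n)\<^sup>2 - (X \<bullet> Jc n)\<^sup>2)"
  by (simp add: coord_defs, simp add: power2_eq_square) algebra

text \<open>The left-hand side is the exterior derivative of the form \<open>\<langle>\<nabla>n, Jn\<rangle>\<close> on \<open>(X, JX)\<close> when \<open>S X = s\<close> and
  \<open>S (JX) = - J s\<close>; \<open>nv\<close> and \<open>nw\<close> are then the derivatives of \<open>n\<close> in the directions \<open>X\<close> and \<open>JX\<close>.\<close>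

lemma hopf_form_expansion:
  fixes n X s :: frame_coords
  defines "Y \<equiv> Jc X" and "nv \<equiv> - s - christoffel X n" and "nw \<equiv> Jc s - christoffel (Jc X) n"
  shows "christoffel (- bracket X Y) n \<bullet> Jc n + christoffel Y nv \<bullet> Jc n - christoffel X nw \<bullet> Jc n
     + (nw + christoffel Y n) \<bullet> Jc nv - (nv + christoffel X n) \<bullet> Jc nw
   = (christoffel X (christoffel (Jc X) n) - christoffel (Jc X) (christoffel X n) - christoffel (bracket X (Jc X)) n) \<bullet> Jc n
      - 2 * (s \<bullet> s) - 2 * (s \<bullet> JG n X)"
  unfolding assms
  by (simp add: coord_defs) algebra

text \<open>In the same situation the exterior derivative of the contact form \<open>\<langle>\<omega>, Jn\<rangle>\<close> vanishes on \<open>(X, JX)\<close>; this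
  is why the principal curvature of \<open>Jn\<close> disappears from the Codazzi equation evaluated there.\<close>

lemma contact_form_expansion:
  fixes n X s :: frame_coords
  defines "Y \<equiv> Jc X" and "nv \<equiv> - s - christoffel X n" and "nw \<equiv> Jc s - christoffel (Jc X) n"
  shows "- (bracket X Y \<bullet> Jc n) + Y \<bullet> Jc nv - X \<bullet> Jc nw = 0"
  unfolding assms
  by (simp add: coord_defs) algebra

lemma bounded_bilinear_christoffel: "bounded_bilinear christoffel"
  by (simp add: bilinear_christoffel bilinear_conv_bounded_bilinear[symmetric])

lemma JG_skew: "JG n X \<bullet> Y = - (X \<bullet> JG n Y)"
  by (simp add: coord_defs algebra_simps)

lemma JG_orth: "n \<bullet> JG n X = 0" "JG n X \<bullet> Jc n = 0"
  by (simp_all add: coord_defs algebra_simps)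

lemma cross_dot_cross: "cross3 a b \<bullet> cross3 c d = (a \<bullet> c) * (b \<bullet> d) - (a \<bullet> d) * (b \<bullet> c)"
  by (simp add: cross3_def inner_vec_def sum_3 algebra_simps)

section \<open>Symmetry of second derivatives\<close>

lemma derivative_of_constant_on_open:
  fixes h :: "'e::real_normed_vector \<Rightarrow> 'b::real_normed_vector"
  assumes "open U" "x \<in> U" "\<And>y. y \<in> U \<Longrightarrow> h y = c" "(h has_derivative h') (at x)"
  shows "h' v = 0"
proof -
  have "((\<lambda>_. c) has_derivative h') (at x)"
    by (rule has_derivative_transform_within_open[OF assms(4,1,2)]) (simp add: assms(3))
  then have "h' = (\<lambda>_. 0)"
    by (rule has_derivative_unique) (rule has_derivative_const)
  then show ?thesis by simp
qed

text \<open>The second difference quotient tends to the second derivative taken first along \<open>v\<close>, then along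
  \<open>w\<close>: the mean value theorem along \<open>v\<close> turns the second difference into a first difference of the
  \<open>v\<close>-derivative, and that derivative is differentiable at \<open>x\<close>. Since the quotient is symmetric in
  \<open>v\<close> and \<open>w\<close>, so is the second derivative.\<close>

lemma second_difference_limit:
  fixes f :: "'a::real_normed_vector \<Rightarrow> real"
  assumes U: "open U" "x \<in> U" and f': "\<And>y. y \<in> U \<Longrightarrow> (f has_derivative f' y) (at y)"
    and D: "((\<lambda>y. f' y v) has_derivative D) (at x)"
  shows "((\<lambda>s. (f (x + s *\<^sub>R v + s *\<^sub>R w) - f (x + s *\<^sub>R v) - f (x + s *\<^sub>R w) + f x) / s\<^sup>2)
           \<longlongrightarrow> D w) (at_right 0)"
proof (rule tendstoI)
  fix e :: real assume "e > 0"
  define K where "K = norm v + norm w + 1"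
  have K: "K > 0" "norm v + norm w \<le> K" by (auto simp: K_def add_nonneg_pos)
  define e' where "e' = e / (4 * K)"
  have e': "e' > 0" using \<open>e > 0\<close> K by (simp add: e'_def)
  interpret D: bounded_linear D using D by (rule has_derivative_bounded_linear)
  obtain d1 where d1: "d1 > 0"
    "\<And>y. norm (y - x) < d1 \<Longrightarrow> norm (f' y v - f' x v - D (y - x)) \<le> e' * norm (y - x)"
    using D e' unfolding has_derivative_at_alt by blast
  obtain d2 where d2: "d2 > 0" "ball x d2 \<subseteq> U" using U openE by blast
  define d where "d = min d1 d2 / K"
  have d: "d > 0" using d1 d2 K by (simp add: d_def)
  have main: "dist ((f (x + s *\<^sub>R v + s *\<^sub>R w) - f (x + s *\<^sub>R v) - f (x + s *\<^sub>R w) + f x) / s\<^sup>2) (D w) < e"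
    if s: "0 < s" "s < d" for s
  proof -
    have sK: "s * K < min d1 d2" using s K by (simp add: d_def field_simps)
    have near: "norm (t *\<^sub>R v + r *\<^sub>R w) \<le> s * K" if "0 \<le> t" "t \<le> s" "0 \<le> r" "r \<le> s" for t r
    proof -
      have "norm (t *\<^sub>R v + r *\<^sub>R w) \<le> t * norm v + r * norm w"
        using norm_triangle_ineq[of "t *\<^sub>R v" "r *\<^sub>R w"] that by simp
      also have "\<dots> \<le> s * norm v + s * norm w"
        using that by (intro add_mono mult_right_mono) auto
      also have "\<dots> = s * (norm v + norm w)" by (simp add: distrib_left)
      also have "\<dots> \<le> s * K" using K s by (intro mult_left_mono) auto
      finally show ?thesis .
    qed
    have inU: "x + t *\<^sub>R v + r *\<^sub>R w \<in> U" if "0 \<le> t" "t \<le> s" "0 \<le> r" "r \<le> s" for t r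
    proof -
      have "norm (t *\<^sub>R v + r *\<^sub>R w) < d2" using near[OF that] sK by linarith
      then have "dist (x + (t *\<^sub>R v + r *\<^sub>R w)) x < d2" by (simp add: dist_norm)
      then have "x + (t *\<^sub>R v + r *\<^sub>R w) \<in> ball x d2" by (simp only: mem_ball dist_commute)
      then show ?thesis using d2 by (auto simp: add.assoc)
    qed
    have inU0: "x + t *\<^sub>R v \<in> U" if "0 \<le> t" "t \<le> s" for t
      using inU[OF that, of 0] s by simp
    define \<phi> where "\<phi> t = f (x + t *\<^sub>R v + s *\<^sub>R w) - f (x + t *\<^sub>R v)" for t
    define \<phi>' where "\<phi>' t = f' (x + t *\<^sub>R v + s *\<^sub>R w) v - f' (x + t *\<^sub>R v) v" for t
    have der: "(\<phi> has_real_derivative \<phi>' t) (at t)" if "0 \<le> t" "t \<le> s" for t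
    proof -
      have l1: "linear (f' (x + t *\<^sub>R v + s *\<^sub>R w))" and l2: "linear (f' (x + t *\<^sub>R v))"
        using f'[OF inU[OF that, of s]] f'[OF inU0[OF that]] s
        by (auto intro: bounded_linear.linear has_derivative_bounded_linear)
      have "((\<lambda>t. f (x + t *\<^sub>R v + s *\<^sub>R w)) has_derivative (\<lambda>r. f' (x + t *\<^sub>R v + s *\<^sub>R w) (r *\<^sub>R v))) (at t)"
        by (rule has_derivative_compose[where f="\<lambda>t. x + t *\<^sub>R v + s *\<^sub>R w" and g=f])
           (use f'[OF inU[OF that, of s]] s in \<open>auto intro!: derivative_eq_intros\<close>)
      moreover have "((\<lambda>t. f (x + t *\<^sub>R v)) has_derivative (\<lambda>r. f' (x + t *\<^sub>R v) (r *\<^sub>R v))) (at t)"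
        by (rule has_derivative_compose[where f="\<lambda>t. x + t *\<^sub>R v" and g=f])
           (use f'[OF inU0[OF that]] in \<open>auto intro!: derivative_eq_intros\<close>)
      ultimately have "(\<phi> has_derivative (\<lambda>r. f' (x + t *\<^sub>R v + s *\<^sub>R w) (r *\<^sub>R v) - f' (x + t *\<^sub>R v) (r *\<^sub>R v))) (at t)"
        unfolding \<phi>_def by (rule has_derivative_diff)
      then have "(\<phi> has_derivative (\<lambda>r. \<phi>' t * r)) (at t)"
        by (simp only: linear_scale[OF l1] linear_scale[OF l2]) (simp add: \<phi>'_def algebra_simps)
      then show ?thesis by (simp add: has_field_derivative_def)
    qed
    obtain t where t: "0 < t" "t < s" "\<phi> s - \<phi> 0 = s * \<phi>' t"
      using MVT2[OF s(1), of \<phi> \<phi>'] der by auto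
    have b1: "norm (f' (x + t *\<^sub>R v + s *\<^sub>R w) v - f' x v - D (t *\<^sub>R v + s *\<^sub>R w)) \<le> e' * (s * K)"
    proof -
      have le: "norm (t *\<^sub>R v + s *\<^sub>R w) \<le> s * K" using near[of t s] t s by auto
      moreover have "norm (f' (x + t *\<^sub>R v + s *\<^sub>R w) v - f' x v - D (t *\<^sub>R v + s *\<^sub>R w))
          \<le> e' * norm (t *\<^sub>R v + s *\<^sub>R w)"
        using d1(2)[of "x + (t *\<^sub>R v + s *\<^sub>R w)"] sK le by (simp add: add.assoc[symmetric])
      ultimately show ?thesis using mult_left_mono[OF le, of e'] e' by linarith
    qed
    have b2: "norm (f' (x + t *\<^sub>R v) v - f' x v - D (t *\<^sub>R v)) \<le> e' * (s * K)"
    proof -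
      have le: "norm (t *\<^sub>R v) \<le> s * K" using near[of t 0] t s by auto
      moreover have "norm (f' (x + t *\<^sub>R v) v - f' x v - D (t *\<^sub>R v)) \<le> e' * norm (t *\<^sub>R v)"
        using d1(2)[of "x + t *\<^sub>R v"] sK le by simp
      ultimately show ?thesis using mult_left_mono[OF le, of e'] e' by linarith
    qed
    have "\<bar>\<phi>' t - s * D w\<bar> \<le> 2 * e' * (s * K)"
      using b1 b2 unfolding \<phi>'_def D.add D.scale real_norm_def real_scaleR_def by linarith
    then have "s * \<bar>\<phi>' t - s * D w\<bar> \<le> s * (2 * e' * (s * K))"
      using s by (intro mult_left_mono) auto
    then have "\<bar>s * \<phi>' t - s\<^sup>2 * D w\<bar> \<le> s\<^sup>2 * (2 * e' * K)"
      using s abs_mult[of s "\<phi>' t - s * D w"] by (simp add: power2_eq_square right_diff_distrib mult.assoc mult.left_commute)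
    also have "2 * e' * K = e / 2" using K by (simp add: e'_def)
    also have "s\<^sup>2 * (e / 2) < s\<^sup>2 * e" using s \<open>e > 0\<close> by simp
    finally have "\<bar>(s * \<phi>' t - s\<^sup>2 * D w) / s\<^sup>2\<bar> < e"
      using s by (simp add: abs_divide divide_less_eq mult.commute)
    moreover have "f (x + s *\<^sub>R v + s *\<^sub>R w) - f (x + s *\<^sub>R v) - f (x + s *\<^sub>R w) + f x = s * \<phi>' t"
      using t(3) by (simp add: \<phi>_def)
    ultimately show ?thesis using s by (simp add: dist_real_def diff_divide_distrib)
  qed
  show "\<forall>\<^sub>F s in at_right 0. dist ((f (x + s *\<^sub>R v + s *\<^sub>R w) - f (x + s *\<^sub>R v) - f (x + s *\<^sub>R w) + f x) / s\<^sup>2) (D w) < e"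
    unfolding eventually_at_right_field using main d by (intro exI[of _ d]) auto
qed

lemma mixed_derivatives_commute:
  fixes f :: "'a::real_normed_vector \<Rightarrow> 'b::euclidean_space"
  assumes U: "open U" "x \<in> U" and f': "\<And>y. y \<in> U \<Longrightarrow> (f has_derivative f' y) (at y)"
    and Dv: "((\<lambda>y. f' y v) has_derivative Dv) (at x)"
    and Dw: "((\<lambda>y. f' y w) has_derivative Dw) (at x)"
  shows "Dv w = Dw v"
proof (rule euclidean_eqI)
  fix b :: 'b assume "b \<in> Basis"
  let ?h = "\<lambda>y. f y \<bullet> b" and ?h' = "\<lambda>y z. f' y z \<bullet> b"
  have h': "(?h has_derivative ?h' y) (at y)" if "y \<in> U" for y
    using f'[OF that] by (rule has_derivative_inner_left)
  have "((\<lambda>s. (?h (x + s *\<^sub>R v + s *\<^sub>R w) - ?h (x + s *\<^sub>R v) - ?h (x + s *\<^sub>R w) + ?h x) / s\<^sup>2)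
           \<longlongrightarrow> Dv w \<bullet> b) (at_right 0)"
    by (rule second_difference_limit[OF U h' has_derivative_inner_left[OF Dv]])
  moreover have "((\<lambda>s. (?h (x + s *\<^sub>R w + s *\<^sub>R v) - ?h (x + s *\<^sub>R w) - ?h (x + s *\<^sub>R v) + ?h x) / s\<^sup>2)
           \<longlongrightarrow> Dw v \<bullet> b) (at_right 0)"
    by (rule second_difference_limit[OF U h' has_derivative_inner_left[OF Dw]])
  moreover have "(\<lambda>s. (?h (x + s *\<^sub>R w + s *\<^sub>R v) - ?h (x + s *\<^sub>R w) - ?h (x + s *\<^sub>R v) + ?h x) / s\<^sup>2)
      = (\<lambda>s. (?h (x + s *\<^sub>R v + s *\<^sub>R w) - ?h (x + s *\<^sub>R v) - ?h (x + s *\<^sub>R w) + ?h x) / s\<^sup>2)"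
    by (simp add: algebra_simps)
  ultimately show "Dv w \<bullet> b = Dw v \<bullet> b"
    using tendsto_unique[OF trivial_limit_at_right_real] by simp
qed

section \<open>The local obstruction\<close>

text \<open>A chart of a hypersurface read in the left-invariant frame: \<open>\<omega>\<close> is the differential of the immersion,
  \<open>n\<close> the unit normal and \<open>S\<close> the shape operator, both rescaled such that \<open>n\<close> is a unit vector for the
  standard inner product. \<open>\<omega>'\<close>, \<open>n'\<close> and \<open>n''\<close> are derivatives, the last argument being the
  direction of the last differentiation.\<close>

locale anticommuting_patch =
  fixes \<Omega> :: "'e::real_normed_vector set"
    and \<omega> :: "'e \<Rightarrow> 'e \<Rightarrow> frame_coords" and \<omega>' :: "'e \<Rightarrow> 'e \<Rightarrow> 'e \<Rightarrow> frame_coords"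
    and n :: "'e \<Rightarrow> frame_coords" and n' :: "'e \<Rightarrow> 'e \<Rightarrow> frame_coords"
    and n'' :: "'e \<Rightarrow> 'e \<Rightarrow> 'e \<Rightarrow> frame_coords"
    and S :: "'e \<Rightarrow> frame_coords \<Rightarrow> frame_coords"
  assumes open_domain: "open \<Omega>"
    and coframe_deriv: "x \<in> \<Omega> \<Longrightarrow> ((\<lambda>y. \<omega> y v) has_derivative \<omega>' x v) (at x)"
    and maurer_cartan: "x \<in> \<Omega> \<Longrightarrow> \<omega>' x v w - \<omega>' x w v = bracket (\<omega> x v) (\<omega> x w)"
    and range_coframe: "x \<in> \<Omega> \<Longrightarrow> range (\<omega> x) = {c. n x \<bullet> c = 0}"
    and normal_unit: "x \<in> \<Omega> \<Longrightarrow> n x \<bullet> n x = 1"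
    and normal_deriv: "x \<in> \<Omega> \<Longrightarrow> (n has_derivative n' x) (at x)"
    and normal_deriv2: "x \<in> \<Omega> \<Longrightarrow> ((\<lambda>y. n' y v) has_derivative n'' x v) (at x)"
    and normal_deriv2_sym: "x \<in> \<Omega> \<Longrightarrow> n'' x v w = n'' x w v"
    and weingarten: "x \<in> \<Omega> \<Longrightarrow> n' x v + christoffel (\<omega> x v) (n x) = - S x (\<omega> x v)"
    and anticommute: "\<lbrakk>x \<in> \<Omega>; n x \<bullet> c = 0\<rbrakk> \<Longrightarrow>
      S x (Jc c - (Jc c \<bullet> n x) *\<^sub>R n x) + (Jc (S x c) - (Jc (S x c) \<bullet> n x) *\<^sub>R n x) = 0"
begin

lemma coframe_surj:
  assumes "x \<in> \<Omega>" "n x \<bullet> c = 0"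
  obtains v where "\<omega> x v = c"
  using range_coframe[OF assms(1)] assms(2) by (metis (mono_tags, lifting) mem_Collect_eq imageE)

lemma coframe_tangent: "x \<in> \<Omega> \<Longrightarrow> n x \<bullet> \<omega> x v = 0"
  using range_coframe by blast

lemma normal_deriv_eq: "x \<in> \<Omega> \<Longrightarrow> n' x v = - S x (\<omega> x v) - christoffel (\<omega> x v) (n x)"
  using weingarten[of x v] by (simp add: eq_diff_eq)

lemma normal_deriv_orth:
  assumes "x \<in> \<Omega>"
  shows "n x \<bullet> n' x v = 0"
proof -
  have "((\<lambda>y. n y \<bullet> n y) has_derivative (\<lambda>v. n x \<bullet> n' x v + n' x v \<bullet> n x)) (at x)"
    by (intro has_derivative_inner normal_deriv assms)
  then have "n x \<bullet> n' x v + n' x v \<bullet> n x = 0"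
    by (intro derivative_of_constant_on_open[OF open_domain assms]) (auto intro: normal_unit)
  then show ?thesis by (simp add: inner_commute)
qed

lemma shape_tangent:
  assumes "x \<in> \<Omega>" "n x \<bullet> c = 0"
  shows "n x \<bullet> S x c = 0"
proof -
  obtain v where "\<omega> x v = c" using coframe_surj[OF assms] .
  moreover have "n x \<bullet> christoffel c (n x) = 0" using christoffel_skew[of c "n x" "n x"] by (simp add: inner_commute)
  ultimately show ?thesis
    using normal_deriv_orth[OF assms(1), of v] by (simp add: normal_deriv_eq[OF assms(1)] inner_diff_right)
qed

text \<open>Differentiate \<open>\<langle>n, \<omega>\<rangle> = 0\<close> and antisymmetrize: the Maurer-Cartan equation produces the bracket, which
  is the antisymmetric part of the connection coefficients, and the rest is the antisymmetric part
  of \<open>S\<close>.\<close>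

lemma shape_symmetric:
  assumes x: "x \<in> \<Omega>" and c: "n x \<bullet> c = 0" and d: "n x \<bullet> d = 0"
  shows "S x c \<bullet> d = c \<bullet> S x d"
proof -
  obtain v where v: "\<omega> x v = c" using coframe_surj[OF x c] .
  obtain w where w: "\<omega> x w = d" using coframe_surj[OF x d] .
  have *: "n x \<bullet> \<omega>' x a b + n' x b \<bullet> \<omega> x a = 0" for a b
  proof -
    have "((\<lambda>y. n y \<bullet> \<omega> y a) has_derivative (\<lambda>b. n x \<bullet> \<omega>' x a b + n' x b \<bullet> \<omega> x a)) (at x)"
      by (intro has_derivative_inner normal_deriv coframe_deriv x)
    then show ?thesis
      by (intro derivative_of_constant_on_open[OF open_domain x]) (auto intro: coframe_tangent)
  qed
  have "n x \<bullet> bracket c d = n x \<bullet> (\<omega>' x v w - \<omega>' x w v)" by (simp add: maurer_cartan[OF x] v w)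
  also have "\<dots> = n' x v \<bullet> d - n' x w \<bullet> c"
    using *[of v w] *[of w v] by (simp add: inner_diff_right v w)
  finally show ?thesis
    using christoffel_skew[of c "n x" d] christoffel_skew[of d "n x" c]
    by (simp add: normal_deriv_eq[OF x] v w bracket_christoffel inner_diff_right inner_diff_left inner_commute)
qed

text \<open>\<open>Jn\<close> spans the kernel of \<open>\<phi>\<close>, so anticommutation puts \<open>S (Jn)\<close> into the kernel of \<open>\<phi>\<close>, too.\<close>

lemma hopf:
  assumes x: "x \<in> \<Omega>"
  obtains \<alpha> where "S x (Jc (n x)) = \<alpha> *\<^sub>R Jc (n x)"
proof -
  let ?U = "Jc (n x)"
  have U: "n x \<bullet> ?U = 0" using inner_Jc_left[of "n x" "n x"] by (simp add: inner_commute)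
  have "n x \<bullet> 0 = 0" by simp
  from shape_symmetric[OF x this shape_tangent[OF x this]] have S0: "S x 0 = 0" by simp
  have "S x (Jc ?U - (Jc ?U \<bullet> n x) *\<^sub>R n x) = 0" by (simp add: normal_unit[OF x] S0)
  with anticommute[OF x U] have "Jc (S x ?U) = (Jc (S x ?U) \<bullet> n x) *\<^sub>R n x" by simp
  then have "Jc (Jc (S x ?U)) = (Jc (S x ?U) \<bullet> n x) *\<^sub>R Jc (n x)"
    by (metis linear_Jc linear_scale)
  then have "S x ?U = (- (Jc (S x ?U) \<bullet> n x)) *\<^sub>R Jc (n x)" by (metis Jc_Jc minus_equation_iff scaleR_minus_left)
  then show thesis by (rule that)
qed

text \<open>By symmetry \<open>S\<close> preserves the orthogonal complement of \<open>n\<close> and \<open>Jn\<close>, and on it \<open>\<phi>\<close> is \<open>J\<close>.\<close>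

lemma shape_antilinear:
  assumes x: "x \<in> \<Omega>" and X: "n x \<bullet> X = 0" "X \<bullet> Jc (n x) = 0"
  shows "S x (Jc X) = - Jc (S x X)"
proof -
  obtain \<alpha> where a: "S x (Jc (n x)) = \<alpha> *\<^sub>R Jc (n x)" using hopf[OF x] .
  have U: "n x \<bullet> Jc (n x) = 0" using inner_Jc_left[of "n x" "n x"] by (simp add: inner_commute)
  have "S x X \<bullet> Jc (n x) = 0" using shape_symmetric[OF x X(1) U] by (simp add: a X)
  then show ?thesis
    using anticommute[OF x X(1)] X by (simp add: inner_Jc_left eq_neg_iff_add_eq_0)
qed

text \<open>The Codazzi equation paired with \<open>Jn\<close> and evaluated on \<open>(X, JX)\<close>. The form \<open>\<theta> = \<langle>\<nabla>n, Jn\<rangle>\<close> is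
  proportional to the contact form \<open>\<eta>\<close>, and the equation follows by differentiating \<open>\<theta> \<and> \<eta> = 0\<close>, in which
  neither \<open>S\<close> nor the factor of proportionality appears. As \<open>d\<eta>(X, JX) = 0\<close>, also \<open>d\<theta>(X, JX) = 0\<close>, and this completes to a square because
  \<open>|J G(X, n)|\<^sup>2 = 4 |X|\<^sup>2\<close>.\<close>

lemma key_identity:
  assumes x: "x \<in> \<Omega>" and X: "n x \<bullet> X = 0" "X \<bullet> Jc (n x) = 0"
  shows "(norm (S x X + (1/2) *\<^sub>R JG (n x) X))\<^sup>2
    = 4 * ((X \<bullet> Pc (n x))\<^sup>2 + (X \<bullet> Jc (Pc (n x)))\<^sup>2)"
proof -
  let ?n = "n x" and ?Y = "Jc X" and ?s = "S x X"
  define \<theta> where "\<theta> y v = (n' y v + christoffel (\<omega> y v) (n y)) \<bullet> Jc (n y)" for y v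
  define \<eta> where "\<eta> y v = \<omega> y v \<bullet> Jc (n y)" for y v
  define \<theta>' where "\<theta>' v w = (n' x v + christoffel (\<omega> x v) ?n) \<bullet> Jc (n' x w)
     + (n'' x v w + (christoffel (\<omega> x v) (n' x w) + christoffel (\<omega>' x v w) ?n)) \<bullet> Jc ?n" for v w
  define \<eta>' where "\<eta>' v w = \<omega> x v \<bullet> Jc (n' x w) + \<omega>' x v w \<bullet> Jc ?n" for v w
  have Jn': "((\<lambda>y. Jc (n y)) has_derivative (\<lambda>w. Jc (n' x w))) (at x)"
    by (rule bounded_linear.has_derivative[OF bounded_linear_Jc normal_deriv[OF x]])
  have d\<theta>: "((\<lambda>y. \<theta> y v) has_derivative \<theta>' v) (at x)" for v
    unfolding \<theta>_def \<theta>'_def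
    by (intro has_derivative_inner has_derivative_add normal_deriv2 normal_deriv coframe_deriv x Jn'
        bounded_bilinear.FDERIV[OF bounded_bilinear_christoffel])
  have d\<eta>: "((\<lambda>y. \<eta> y v) has_derivative \<eta>' v) (at x)" for v
    unfolding \<eta>_def \<eta>'_def by (intro has_derivative_inner coframe_deriv x Jn')
  have U: "n y \<bullet> Jc (n y) = 0" for y using inner_Jc_left[of "n y" "n y"] by (simp add: inner_commute)
  have collinear: "\<exists>\<alpha>. \<forall>v. \<theta> y v = - \<alpha> * \<eta> y v" if y: "y \<in> \<Omega>" for y
  proof -
    obtain \<alpha> where a: "S y (Jc (n y)) = \<alpha> *\<^sub>R Jc (n y)" using hopf[OF y] .
    have "\<theta> y v = - \<alpha> * \<eta> y v" for v
      using shape_symmetric[OF y coframe_tangent[OF y] U, of v] weingarten[OF y, of v]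
      by (simp add: a \<theta>_def \<eta>_def)
    then show ?thesis by blast
  qed
  (* The derivative of theta /\ eta = 0; evaluated at Jn, where eta = 1, it compares theta' with eta'
     up to the factor - alpha. *)
  have wedge: "\<theta> x v * \<eta>' u w + \<theta>' v w * \<eta> x u - (\<theta> x u * \<eta>' v w + \<theta>' u w * \<eta> x v) = 0" for u v w
  proof -
    have D: "((\<lambda>y. \<theta> y v * \<eta> y u - \<theta> y u * \<eta> y v) has_derivative
      (\<lambda>w. \<theta> x v * \<eta>' u w + \<theta>' v w * \<eta> x u - (\<theta> x u * \<eta>' v w + \<theta>' u w * \<eta> x v))) (at x)"
      by (intro has_derivative_diff has_derivative_mult d\<theta> d\<eta>)
    have "\<theta> y v * \<eta> y u - \<theta> y u * \<eta> y v = 0" if "y \<in> \<Omega>" for y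
      using collinear[OF that] by auto
    from derivative_of_constant_on_open[OF open_domain x this D] show ?thesis .
  qed
  have Y: "?n \<bullet> ?Y = 0" "?Y \<bullet> Jc ?n = 0" using X by (simp_all add: inner_Jc_left inner_commute)
  obtain vX where vX: "\<omega> x vX = X" using coframe_surj[OF x X(1)] .
  obtain vY where vY: "\<omega> x vY = ?Y" using coframe_surj[OF x Y(1)] .
  obtain vU where vU: "\<omega> x vU = Jc ?n" using coframe_surj[OF x U] .
  obtain \<alpha> where \<alpha>: "\<And>v. \<theta> x v = - \<alpha> * \<eta> x v" using collinear[OF x] by blast
  have "\<eta> x vX = 0" "\<eta> x vY = 0" "\<eta> x vU = 1"
    using X Y normal_unit[OF x] by (simp_all add: \<eta>_def vX vY vU)
  then have "\<theta>' vX vY = - \<alpha> * \<eta>' vX vY" "\<theta>' vY vX = - \<alpha> * \<eta>' vY vX"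
    using wedge[of vX vU vY] wedge[of vY vU vX] \<alpha> by simp_all
  then have balance: "\<theta>' vY vX - \<theta>' vX vY = - \<alpha> * (\<eta>' vY vX - \<eta>' vX vY)"
    by (simp add: algebra_simps)
  have nX: "n' x vX = - ?s - christoffel X ?n" by (simp add: normal_deriv_eq[OF x] vX)
  have nY: "n' x vY = Jc ?s - christoffel ?Y ?n"
    by (simp add: normal_deriv_eq[OF x] vY shape_antilinear[OF x X])
  have tors: "\<omega>' x vY vX = \<omega>' x vX vY - bracket X ?Y"
    using maurer_cartan[OF x, of vX vY] by (simp add: vX vY algebra_simps)
  have christoffel_diff: "christoffel (a - b) c = christoffel a c - christoffel b c" "christoffel (- b) c = - christoffel b c" for a b c
    by (simp_all add: bilinear_lsub[OF bilinear_christoffel] bilinear_lneg[OF bilinear_christoffel])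
  have "\<eta>' vY vX - \<eta>' vX vY
      = - (bracket X ?Y \<bullet> Jc ?n) + ?Y \<bullet> Jc (n' x vX) - X \<bullet> Jc (n' x vY)"
    by (simp add: \<eta>'_def tors vX vY inner_diff_left)
  also have "\<dots> = 0" unfolding nX nY by (rule contact_form_expansion)
  finally have "\<theta>' vY vX - \<theta>' vX vY = 0" using balance by simp
  also have "\<theta>' vY vX - \<theta>' vX vY
      = christoffel (- bracket X ?Y) ?n \<bullet> Jc ?n + christoffel ?Y (n' x vX) \<bullet> Jc ?n - christoffel X (n' x vY) \<bullet> Jc ?n
      + (n' x vY + christoffel ?Y ?n) \<bullet> Jc (n' x vX) - (n' x vX + christoffel X ?n) \<bullet> Jc (n' x vY)"
    by (simp add: \<theta>'_def tors vX vY inner_diff_left inner_add_left christoffel_diff normal_deriv2_sym[OF x, of vY vX])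
  also have "\<dots> = (christoffel X (christoffel ?Y ?n) - christoffel ?Y (christoffel X ?n) - christoffel (bracket X ?Y) ?n) \<bullet> Jc ?n
      - 2 * (?s \<bullet> ?s) - 2 * (?s \<bullet> JG ?n X)"
    unfolding nX nY by (rule hopf_form_expansion)
  also have "\<dots> = 8 * ((X \<bullet> Pc ?n)\<^sup>2 + (X \<bullet> Jc (Pc ?n))\<^sup>2) - 2 * (X \<bullet> X)
      - 2 * (?s \<bullet> ?s) - 2 * (?s \<bullet> JG ?n X)"
    unfolding curvature_identity using X normal_unit[OF x] by (simp add: inner_commute)
  finally have "2 * (?s \<bullet> ?s) + 2 * (?s \<bullet> JG ?n X) + 2 * (X \<bullet> X)
      = 8 * ((X \<bullet> Pc ?n)\<^sup>2 + (X \<bullet> Jc (Pc ?n))\<^sup>2)" by simp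
  moreover have "JG ?n X \<bullet> JG ?n X = 4 * (X \<bullet> X)"
    using X normal_unit[OF x] by (simp add: JG_norm inner_commute)
  moreover have "(norm (?s + (1/2) *\<^sub>R JG ?n X))\<^sup>2 = ?s \<bullet> ?s + ?s \<bullet> JG ?n X + (1/4) * (JG ?n X \<bullet> JG ?n X)"
    by (simp add: power2_norm_eq_inner inner_add_left inner_add_right inner_commute)
  ultimately show ?thesis by simp
qed

lemma shape_kernel:
  assumes x: "x \<in> \<Omega>" and X: "n x \<bullet> X = 0" "X \<bullet> Jc (n x) = 0" "X \<bullet> Pc (n x) = 0" "X \<bullet> Jc (Pc (n x)) = 0"
  shows "S x X = (- 1/2) *\<^sub>R JG (n x) X"
  using key_identity[OF x X(1,2)] X(3,4) by (simp add: add_eq_0_iff2)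

text \<open>Take \<open>b = (z, 0)\<close> with \<open>z\<close> orthogonal to both parts \<open>u\<close>, \<open>w\<close> of \<open>n\<close>, so that the key identity gives
  \<open>S b = - Y / 2\<close> with \<open>Y = J G(b, n)\<close>. At \<open>Y\<close> the left-hand side of the identity is bounded below through its
  \<open>b\<close>-component, which symmetry of \<open>S\<close> and skewness of \<open>J G(\<cdot>, n)\<close> make known, and the right-hand side is a
  multiple of \<open>\<langle>z, u \<times> w\<rangle>\<^sup>2\<close>. This forces \<open>1 \<le> 4 |u \<times> w|\<^sup>2\<close>, whereas \<open>|u|\<^sup>2 + |w|\<^sup>2 = 1\<close> gives the reverse inequality, with
  equality only in the stated case.\<close>

lemma normal_form:
  assumes x: "x \<in> \<Omega>"
  shows "fst (n x) \<bullet> fst (n x) = 1/2" "snd (n x) \<bullet> snd (n x) = 1/2" "fst (n x) \<bullet> snd (n x) = 0"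
proof -
  let ?u = "fst (n x)" and ?w = "snd (n x)"
  have "dim {?u, ?w} < DIM(real^3)"
    using dim_le_card'[of "{?u, ?w}"] card_insert_le_m1[of 2 "{?w}" ?u] by simp
  then obtain z where z: "z \<noteq> 0" "span {?u, ?w} \<subseteq> {y. z \<bullet> y = 0}"
    using lowdim_subset_hyperplane by blast
  then have zu: "z \<bullet> ?u = 0" "z \<bullet> ?w = 0" using span_base[of _ "{?u, ?w}"] by blast+
  define b :: frame_coords where "b = (z, 0)"
  have b: "n x \<bullet> b = 0" "b \<bullet> Jc (n x) = 0" "b \<bullet> Pc (n x) = 0" "b \<bullet> Jc (Pc (n x)) = 0"
    using zu by (simp_all add: b_def inner_prod_def Jc_def Pc_def inner_commute)
  define Y where "Y = JG (n x) b"
  have Y: "n x \<bullet> Y = 0" "Y \<bullet> Jc (n x) = 0" unfolding Y_def by (rule JG_orth)+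
  have YY: "Y \<bullet> Y = 4 * (z \<bullet> z)"
    unfolding Y_def JG_norm using b by (simp add: normal_unit[OF x] inner_commute) (simp add: b_def)
  have "S x Y \<bullet> b = Y \<bullet> S x b" by (rule shape_symmetric[OF x Y(1) b(1)])
  also have "\<dots> = - 2 * (z \<bullet> z)" unfolding shape_kernel[OF x b] by (simp add: Y_def[symmetric] YY)
  finally have "(S x Y + (1/2) *\<^sub>R JG (n x) Y) \<bullet> b = - 4 * (z \<bullet> z)"
    using JG_skew[of "n x" Y b] YY by (simp add: inner_add_left Y_def[symmetric])
  then have "(4 * (z \<bullet> z))\<^sup>2 \<le> (norm (S x Y + (1/2) *\<^sub>R JG (n x) Y))\<^sup>2 * (z \<bullet> z)"
    using Cauchy_Schwarz_ineq[of "S x Y + (1/2) *\<^sub>R JG (n x) Y" b]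
    by (simp add: power2_norm_eq_inner b_def)
  also have "(norm (S x Y + (1/2) *\<^sub>R JG (n x) Y))\<^sup>2 = 4 * (4 * (z \<bullet> cross3 ?u ?w))\<^sup>2"
  proof -
    have "Y \<bullet> Pc (n x) = 0" "Y \<bullet> Jc (Pc (n x)) = - 4 * (z \<bullet> cross3 ?u ?w)"
      unfolding Y_def b_def by (simp_all add: coord_defs) (simp_all add: algebra_simps)
    then show ?thesis unfolding key_identity[OF x Y] by (simp add: power2_eq_square)
  qed
  finally have *: "16 * (z \<bullet> z)\<^sup>2 \<le> 64 * (z \<bullet> cross3 ?u ?w)\<^sup>2 * (z \<bullet> z)"
    by (simp add: power_mult_distrib)
  have zz: "z \<bullet> z > 0" using z by simp
  have "z \<bullet> z \<le> 4 * (z \<bullet> cross3 ?u ?w)\<^sup>2" using * zz by (simp add: power2_eq_square)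
  also have "\<dots> \<le> (z \<bullet> z) * (4 * (cross3 ?u ?w \<bullet> cross3 ?u ?w))"
    using Cauchy_Schwarz_ineq[of z "cross3 ?u ?w"] by (simp add: mult.left_commute)
  finally have "1 \<le> 4 * (cross3 ?u ?w \<bullet> cross3 ?u ?w)"
    using zz mult_le_cancel_left_pos[OF zz, of 1] by simp
  also have "cross3 ?u ?w \<bullet> cross3 ?u ?w = (?u \<bullet> ?u) * (?w \<bullet> ?w) - (?u \<bullet> ?w)\<^sup>2"
    by (simp add: cross_dot_cross inner_commute power2_eq_square)
  finally have ineq: "1 \<le> 4 * ((?u \<bullet> ?u) * (?w \<bullet> ?w) - (?u \<bullet> ?w)\<^sup>2)" .
  have one: "?w \<bullet> ?w = 1 - ?u \<bullet> ?u" using normal_unit[OF x] by (simp add: inner_prod_def)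
  have "(2 * (?u \<bullet> ?u) - 1)\<^sup>2 + (2 * (?u \<bullet> ?w))\<^sup>2 \<le> 0"
    using ineq unfolding one by (simp add: power2_eq_square algebra_simps)
  then have "2 * (?u \<bullet> ?u) - 1 = 0 \<and> 2 * (?u \<bullet> ?w) = 0"
    by (simp only: sum_power2_le_zero_iff)
  then show "?u \<bullet> ?u = 1/2" "?w \<bullet> ?w = 1/2" "?u \<bullet> ?w = 0" using one by simp_all
qed

definition k where "k = (\<lambda>x. cross3 (fst (n x)) (snd (n x)))"

lemma frame_relations:
  assumes x: "x \<in> \<Omega>"
  shows "cross3 (k x) (fst (n x)) = (1/2) *\<^sub>R snd (n x)" "cross3 (k x) (snd (n x)) = (-1/2) *\<^sub>R fst (n x)"
    "k x \<bullet> k x = 1/4" "k x \<bullet> fst (n x) = 0" "k x \<bullet> snd (n x) = 0"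
proof -
  note nf = normal_form[OF x]
  have nf': "snd (n x) \<bullet> fst (n x) = 0" using nf(3) by (simp add: inner_commute)
  have swap: "cross3 (k x) y = - cross3 y (k x)" for y by (rule cross_skew)
  show "cross3 (k x) (fst (n x)) = (1/2) *\<^sub>R snd (n x)"
    unfolding swap by (simp add: k_def Lagrange nf nf')
  show "cross3 (k x) (snd (n x)) = (-1/2) *\<^sub>R fst (n x)"
    unfolding swap by (simp add: k_def Lagrange nf nf')
  show "k x \<bullet> k x = 1/4" by (simp add: k_def cross_dot_cross nf nf')
  show "k x \<bullet> fst (n x) = 0" "k x \<bullet> snd (n x) = 0" by (simp_all add: k_def dot_cross_self)
qed

lemma shape_on_k:
  assumes x: "x \<in> \<Omega>"
  shows "S x (k x, 0) = (1/2) *\<^sub>R (snd (n x), fst (n x))"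
    and "S x (0, k x) = (1/2) *\<^sub>R (fst (n x), - snd (n x))"
proof -
  note fr = frame_relations[OF x]
  have "S x (k x, 0) = (-1/2) *\<^sub>R JG (n x) (k x, 0)" "S x (0, k x) = (-1/2) *\<^sub>R JG (n x) (0, k x)"
    using fr by (intro shape_kernel[OF x]; simp add: inner_prod_def Jc_def Pc_def inner_commute)+
  then show "S x (k x, 0) = (1/2) *\<^sub>R (snd (n x), fst (n x))"
    "S x (0, k x) = (1/2) *\<^sub>R (fst (n x), - snd (n x))"
    by (simp_all add: JG_def fr)
qed

text \<open>The derivative of \<open>u\<close> in the direction \<open>k\<close> involves \<open>S\<close> only through \<open>S (k, 0)\<close>, by symmetry, and is
  therefore an explicit 1-form, which turns out to be minus the contact form.\<close>

lemma contact_form_eq: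
  assumes x: "x \<in> \<Omega>"
  shows "\<omega> x v \<bullet> Jc (n x) + fst (n' x v) \<bullet> k x = 0"
proof -
  note fr = frame_relations[OF x]
  let ?c = "\<omega> x v"
  have k: "n x \<bullet> (k x, 0) = 0" using fr by (simp add: inner_prod_def inner_commute)
  have "fst (n' x v) \<bullet> k x = n' x v \<bullet> (k x, 0)" by (simp add: inner_prod_def)
  also have "\<dots> = - (?c \<bullet> S x (k x, 0)) + n x \<bullet> christoffel ?c (k x, 0)"
    unfolding normal_deriv_eq[OF x] using shape_symmetric[OF x coframe_tangent[OF x] k] christoffel_skew
    by (simp add: inner_diff_left)
  also have "n x \<bullet> christoffel ?c (k x, 0)
      = 3 * (fst ?c \<bullet> cross3 (k x) (fst (n x))) + snd ?c \<bullet> cross3 (k x) (snd (n x))"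
    by (simp add: coord_defs algebra_simps)
  finally show ?thesis
    by (simp add: shape_on_k[OF x] fr inner_prod_def Jc_def algebra_simps)
qed

text \<open>Differentiate \<open>\<langle>\<omega>, Jn\<rangle> + \<langle>du, k\<rangle> = 0\<close> and antisymmetrize in the directions with coframe values \<open>(k, 0)\<close> and
  \<open>(u, -w)\<close>, where every term is known: the sum is \<open>-2\<close> instead of \<open>0\<close>.\<close>

lemma empty_domain: "\<Omega> = {}"
proof (rule ccontr)
  assume "\<Omega> \<noteq> {}"
  then obtain x where x: "x \<in> \<Omega>" by blast
  note fr = frame_relations[OF x] and nf = normal_form[OF x]
  let ?u = "fst (n x)" and ?w = "snd (n x)" and ?k = "k x"
  define k' where "k' v = cross3 ?u (snd (n' x v)) + cross3 (fst (n' x v)) ?w" for v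
  have k': "(k has_derivative k') (at x)"
    unfolding k_def k'_def
    by (rule bounded_bilinear.FDERIV[OF bilinear_conv_bounded_bilinear[THEN iffD1, OF bilinear_cross]
          has_derivative_fst[OF normal_deriv[OF x]] has_derivative_snd[OF normal_deriv[OF x]]])
  have Jn': "((\<lambda>y. Jc (n y)) has_derivative (\<lambda>w. Jc (n' x w))) (at x)"
    by (rule bounded_linear.has_derivative[OF bounded_linear_Jc normal_deriv[OF x]])
  have second: "\<omega> x v \<bullet> Jc (n' x w) + \<omega>' x v w \<bullet> Jc (n x)
      + (fst (n' x v) \<bullet> k' w + fst (n'' x v w) \<bullet> k x) = 0" for v w
  proof -
    have "((\<lambda>y. \<omega> y v \<bullet> Jc (n y) + fst (n' y v) \<bullet> k y) has_derivative
        (\<lambda>w. \<omega> x v \<bullet> Jc (n' x w) + \<omega>' x v w \<bullet> Jc (n x)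
          + (fst (n' x v) \<bullet> k' w + fst (n'' x v w) \<bullet> k x))) (at x)"
      by (intro has_derivative_add has_derivative_inner Jn' k' has_derivative_fst normal_deriv2 coframe_deriv x)
    from derivative_of_constant_on_open[OF open_domain x _ this] show ?thesis
      using contact_form_eq by blast
  qed
  (* In the first direction the derivatives of n and k are known. In the second one only <dw, k> enters,
     which symmetry of S reduces to S (0, k). Both directions are orthogonal to Jn, so its eigenvalue
     does not enter. *)
  have tang: "n x \<bullet> (?k, 0) = 0" "n x \<bullet> (0, ?k) = 0" "n x \<bullet> (?u, - ?w) = 0"
    using fr nf by (simp_all add: inner_prod_def inner_commute)
  obtain v where v: "\<omega> x v = (?k, 0)" using coframe_surj[OF x tang(1)] .
  obtain w where w: "\<omega> x w = (?u, - ?w)" using coframe_surj[OF x tang(3)] .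
  have nv: "n' x v = (- 2 *\<^sub>R ?w, 2 *\<^sub>R ?u)"
    unfolding normal_deriv_eq[OF x] v shape_on_k[OF x]
    by (simp add: christoffel_def fr prod_eq_iff scaleR_left.add[symmetric] algebra_simps) 
  define q where "q = snd (n' x w)"
  have qk: "q \<bullet> ?k = -2"
  proof -
    have "q \<bullet> ?k = n' x w \<bullet> (0, ?k)" by (simp add: q_def inner_prod_def)
    also have "\<dots> = - ((?u, - ?w) \<bullet> S x (0, ?k)) - christoffel (?u, - ?w) (n x) \<bullet> (0, ?k)"
      unfolding normal_deriv_eq[OF x] w using shape_symmetric[OF x tang(3) tang(2)]
      by (simp add: inner_diff_left)
    also have "christoffel (?u, - ?w) (n x) \<bullet> (0, ?k) = 6 * (?k \<bullet> ?k)"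
      by (simp add: christoffel_def inner_prod_def k_def cross_minus_left cross_skew[of ?w ?u] inner_add_left)
    finally show ?thesis by (simp add: shape_on_k[OF x] fr nf inner_prod_def)
  qed
  have 1: "(\<omega>' x v w - \<omega>' x w v) \<bullet> Jc (n x) = 0"
    unfolding maurer_cartan[OF x] v w
    by (simp add: bracket_def Jc_def inner_prod_def cross_minus_right fr nf)
  have 2: "\<omega> x v \<bullet> Jc (n' x w) = 2"
    using qk by (simp add: v Jc_def inner_prod_def q_def[symmetric] inner_commute)
  have 3: "\<omega> x w \<bullet> Jc (n' x v) = 0"
    by (simp add: w nv Jc_def inner_prod_def nf)
  have 4: "fst (n' x v) \<bullet> k' w = -4"
  proof -
    have "?w \<bullet> cross3 ?u q = - (q \<bullet> ?k)" "?w \<bullet> cross3 (fst (n' x w)) ?w = 0"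
      by (simp_all add: coord_defs k_def algebra_simps)
    then show ?thesis by (simp add: nv k'_def q_def[symmetric] inner_add_right qk)
  qed
  have 5: "k' v = 0"
    by (simp add: k'_def nv cross_mult_left cross_mult_right)
  from second[of v w] second[of w v] show False
    using 1 2 3 4 5 by (simp add: normal_deriv2_sym[OF x, of w v] inner_diff_left)
qed

end

section \<open>The left-invariant frame\<close>

definition qconj :: "quat \<Rightarrow> quat"
  where "qconj p = (fst p, - snd p)"

lemmas quat_defs = qmult_def qconj_def prod_eq_iff vec_eq_iff forall_3 cross3_def inner_vec_def sum_3

lemma qmult_assoc: "a \<odot> b \<odot> c = a \<odot> (b \<odot> c)"
  by (simp add: quat_defs algebra_simps)

lemma norm_one_quat: "norm p = 1 \<longleftrightarrow> fst p * fst p + snd p \<bullet> snd p = 1" for p :: quat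
  by (simp add: norm_eq_1 inner_prod_def)

lemma qconj_qmult: "norm p = 1 \<Longrightarrow> qconj p \<odot> p = (1, 0)" "norm p = 1 \<Longrightarrow> p \<odot> qconj p = (1, 0)"
  unfolding norm_one_quat by (simp_all add: qmult_def qconj_def)

lemma qmult_one: "(1, 0) \<odot> p = p" "p \<odot> (1, 0) = p"
  by (simp_all add: qmult_def)

lemma qinv_unit: "norm p = 1 \<Longrightarrow> qinv p = qconj p"
  by (simp add: qinv_def qconj_def)

lemma qmult_cancel: "norm p = 1 \<Longrightarrow> qconj p \<odot> (p \<odot> a) = a" "norm p = 1 \<Longrightarrow> p \<odot> (qconj p \<odot> a) = a"
  by (simp_all add: qmult_assoc[symmetric] qconj_qmult qmult_one)

lemma inner_qmult_left: "(p \<odot> a) \<bullet> (p \<odot> b) = (p \<bullet> p) * (a \<bullet> b)"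
  by (simp add: qmult_def inner_prod_def cross3_def inner_vec_def sum_3) algebra

lemma qmult_pure_orth: "(p \<odot> (0, c)) \<bullet> p = 0"
  by (simp add: qmult_def inner_prod_def cross3_def inner_vec_def sum_3 algebra_simps)

lemma fst_qconj_qmult: "fst (qconj p \<odot> V) = p \<bullet> V"
  by (simp add: qmult_def qconj_def inner_prod_def)

text \<open>The factors 3 and \<open>sqrt 3\<close> make \<open>J\<close> the map \<open>(x, y) \<mapsto> (-y, x)\<close> and \<open>g\<close> a multiple of the standard inner
  product while the coefficients of \<open>bracket\<close> and \<open>christoffel\<close> stay rational.\<close>

definition frame :: "quat2 \<Rightarrow> frame_coords \<Rightarrow> quat2"
  where "frame x X = (fst x \<odot> (0, 3 *\<^sub>R fst X + sqrt 3 *\<^sub>R snd X),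
                      snd x \<odot> (0, 3 *\<^sub>R fst X - sqrt 3 *\<^sub>R snd X))"

text \<open>Inverse to \<open>frame x\<close> on tangent vectors. It uses the conjugate instead of \<open>qinv\<close>, so that it is bilinear
  and can be differentiated by the product rule.\<close>

definition coords :: "quat2 \<Rightarrow> quat2 \<Rightarrow> frame_coords"
  where "coords x Z =
    ((1 / 6) *\<^sub>R (snd (qconj (fst x) \<odot> fst Z) + snd (qconj (snd x) \<odot> snd Z)),
     (1 / (2 * sqrt 3)) *\<^sub>R (snd (qconj (fst x) \<odot> fst Z) - snd (qconj (snd x) \<odot> snd Z)))"

lemma bilinear_frame: "bilinear frame"
  unfolding bilinear_def
  by (intro conjI allI linearI; simp add: frame_def qmult_def prod_eq_iff inner_add_left inner_add_right
      inner_diff_right cross_add_left cross_add_right cross_mult_left cross_mult_right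
      Cross3.right_diff_distrib algebra_simps)

lemma bilinear_coords: "bilinear coords"
  unfolding bilinear_def
  by (intro conjI allI linearI; simp add: coords_def qconj_def qmult_def prod_eq_iff Cross3.left_diff_distrib
      cross_add_left cross_add_right cross_mult_left cross_mult_right algebra_simps)

lemmas bounded_bilinear_frame = bilinear_conv_bounded_bilinear[THEN iffD1, OF bilinear_frame]
lemmas bounded_bilinear_coords = bilinear_conv_bounded_bilinear[THEN iffD1, OF bilinear_coords]

lemma frame_tangent: "frame x X \<in> tangent_S3S3 x"
  by (simp add: tangent_S3S3_def frame_def qmult_pure_orth)

lemma coords_frame:
  assumes "x \<in> S3S3"
  shows "coords x (frame x X) = X"
proof -
  have "norm (fst x) = 1" "norm (snd x) = 1" using assms by (auto simp: S3S3_def)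
  then show ?thesis
    by (simp add: coords_def frame_def qmult_cancel prod_eq_iff scaleR_left_distrib[symmetric])
qed

lemma frame_coords:
  assumes "x \<in> S3S3" "Z \<in> tangent_S3S3 x"
  shows "frame x (coords x Z) = Z"
proof -
  have n: "norm (fst x) = 1" "norm (snd x) = 1" using assms by (auto simp: S3S3_def)
  have pure: "p \<odot> (0, snd (qconj p \<odot> V)) = V" if "norm p = 1" "V \<bullet> p = 0" for p V :: quat
  proof -
    have "(0, snd (qconj p \<odot> V)) = qconj p \<odot> V"
      using that(2) by (simp add: prod_eq_iff fst_qconj_qmult inner_commute)
    then show ?thesis by (simp add: qmult_cancel that(1))
  qed
  have *: "(1/2) *\<^sub>R (a + b) + (1/2) *\<^sub>R (a - b) = a" "(1/2) *\<^sub>R (a + b) - (1/2) *\<^sub>R (a - b) = b" for a b :: "real^3"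
    by (simp_all add: vec_eq_iff forall_3 field_simps)
  from assms(2) have "fst Z \<bullet> fst x = 0" "snd Z \<bullet> snd x = 0" by (auto simp: tangent_S3S3_def)
  then show ?thesis by (simp add: frame_def coords_def * pure n)
qed

lemma J_frame:
  assumes "x \<in> S3S3"
  shows "J x (frame x X) = frame x (Jc X)"
proof -
  have n: "norm (fst x) = 1" "norm (snd x) = 1" using assms by (auto simp: S3S3_def)
  have s: "sqrt 3 * sqrt 3 = 3" by simp
  define r where "r = sqrt 3"
  have r: "1 / r = r / 3" "r * r = 3" using s by (simp_all add: r_def field_simps)
  have "J x (frame x X) = (r / 3) *\<^sub>R
      (2 *\<^sub>R (fst x \<odot> (0, 3 *\<^sub>R fst X - r *\<^sub>R snd X)) - fst x \<odot> (0, 3 *\<^sub>R fst X + r *\<^sub>R snd X),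
       (-2) *\<^sub>R (snd x \<odot> (0, 3 *\<^sub>R fst X + r *\<^sub>R snd X)) + snd x \<odot> (0, 3 *\<^sub>R fst X - r *\<^sub>R snd X))"
    unfolding J_def frame_def r(1)[symmetric] r_def[symmetric]
    by (simp add: qinv_unit n qmult_assoc qmult_cancel)
  also have "\<dots> = (fst x \<odot> (0, (r / 3) *\<^sub>R (2 *\<^sub>R (3 *\<^sub>R fst X - r *\<^sub>R snd X) - (3 *\<^sub>R fst X + r *\<^sub>R snd X))),
       snd x \<odot> (0, (r / 3) *\<^sub>R ((-2) *\<^sub>R (3 *\<^sub>R fst X + r *\<^sub>R snd X) + (3 *\<^sub>R fst X - r *\<^sub>R snd X))))"
    by (simp add: qmult_def prod_eq_iff inner_add_right inner_diff_right cross_add_right cross_mult_right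
        Cross3.right_diff_distrib algebra_simps)
  also have "(r / 3) *\<^sub>R (2 *\<^sub>R (3 *\<^sub>R fst X - r *\<^sub>R snd X) - (3 *\<^sub>R fst X + r *\<^sub>R snd X))
      = 3 *\<^sub>R (- snd X) + r *\<^sub>R fst X"
    using r(2) by (simp add: vec_eq_iff field_simps)
  also have "(r / 3) *\<^sub>R ((-2) *\<^sub>R (3 *\<^sub>R fst X + r *\<^sub>R snd X) + (3 *\<^sub>R fst X - r *\<^sub>R snd X))
      = 3 *\<^sub>R (- snd X) - r *\<^sub>R fst X"
    using r(2) by (simp add: vec_eq_iff field_simps)
  finally show ?thesis by (simp add: frame_def Jc_def r_def)
qed

lemma inner_frame:
  assumes "x \<in> S3S3"
  shows "frame x X \<bullet> frame x Y = 18 * (fst X \<bullet> fst Y) + 6 * (snd X \<bullet> snd Y)"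
proof -
  have n: "fst x \<bullet> fst x = 1" "snd x \<bullet> snd x = 1" using assms by (auto simp: S3S3_def norm_eq_1)
  have "frame x X \<bullet> frame x Y = (fst x \<odot> (0, 3 *\<^sub>R fst X + sqrt 3 *\<^sub>R snd X)) \<bullet> (fst x \<odot> (0, 3 *\<^sub>R fst Y + sqrt 3 *\<^sub>R snd Y))
     + (snd x \<odot> (0, 3 *\<^sub>R fst X - sqrt 3 *\<^sub>R snd X)) \<bullet> (snd x \<odot> (0, 3 *\<^sub>R fst Y - sqrt 3 *\<^sub>R snd Y))"
    by (simp add: frame_def inner_prod_def[of "(_, _)"])
  also have "\<dots> = 18 * (fst X \<bullet> fst Y) + 6 * (snd X \<bullet> snd Y)"
    unfolding inner_qmult_left n
    by (simp add: inner_prod_def inner_add_left inner_add_right inner_diff_left inner_diff_right algebra_simps)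
  finally show ?thesis .
qed

lemma g_frame:
  assumes "x \<in> S3S3"
  shows "g x (frame x X) (frame x Y) = 12 * (X \<bullet> Y)"
  by (simp add: g_def J_frame[OF assms] inner_frame[OF assms] Jc_def inner_prod_def[of X])

text \<open>The bracket of two left-invariant fields: \<open>x \<mapsto> frame x Y\<close> is linear, so that \<open>frame (frame x X) Y\<close> is its
  derivative in the direction \<open>frame x X\<close>.\<close>

lemma frame_frame: "frame (frame x X) Y - frame (frame x Y) X = frame x (bracket X Y)"
proof -
  define r where "r = sqrt 3"
  have r: "r * r = 3" by (simp add: r_def)
  have rr: "r * (r * z) = 3 * z" for z by (simp add: mult.assoc[symmetric] r)
  have comm: "p \<odot> (0, a) \<odot> (0, b) - p \<odot> (0, b) \<odot> (0, a) = p \<odot> (0, 2 *\<^sub>R cross3 a b)" for p a b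
    by (simp add: quat_defs algebra_simps)
  have 1: "2 *\<^sub>R cross3 (3 *\<^sub>R fst X + r *\<^sub>R snd X) (3 *\<^sub>R fst Y + r *\<^sub>R snd Y)
     = 3 *\<^sub>R fst (bracket X Y) + r *\<^sub>R snd (bracket X Y)"
    by (simp add: bracket_def vec_eq_iff forall_3 cross3_def algebra_simps rr)
  have 2: "2 *\<^sub>R cross3 (3 *\<^sub>R fst X - r *\<^sub>R snd X) (3 *\<^sub>R fst Y - r *\<^sub>R snd Y)
     = 3 *\<^sub>R fst (bracket X Y) - r *\<^sub>R snd (bracket X Y)"
    by (simp add: bracket_def vec_eq_iff forall_3 cross3_def algebra_simps rr)
  show ?thesis
    unfolding frame_def r_def[symmetric] by (simp add: comm 1 2)
qed

text \<open>The same bracket as it appears when \<open>coords (f y) (f' y v)\<close> is differentiated through its first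
  argument; this gives the Maurer-Cartan equation of an immersion.\<close>

lemma coords_frame_frame:
  assumes "x \<in> S3S3"
  shows "coords (frame x Y) (frame x X) - coords (frame x X) (frame x Y) = bracket X Y"
proof -
  define r where "r = sqrt 3"
  have r: "r * r = 3" "r \<noteq> 0" by (simp_all add: r_def)
  have rr: "r * (r * z) = 3 * z" for z by (simp add: mult.assoc[symmetric] r)
  have n: "norm (fst x) = 1" "norm (snd x) = 1" using assms by (auto simp: S3S3_def)
  have conj: "qconj (p \<odot> a) = qconj a \<odot> qconj p" for p a
    by (simp add: quat_defs algebra_simps)
  have cancel: "qconj (p \<odot> a) \<odot> (p \<odot> b) = qconj a \<odot> b" if "norm p = 1" for p a b
    by (simp add: conj qmult_assoc qmult_cancel that)
  have comm: "snd (qconj (0, b) \<odot> (0, a)) = cross3 a b" for a b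
    by (simp add: quat_defs)
  show ?thesis
    unfolding coords_def frame_def r_def[symmetric]
    using r by (simp add: cancel n comm bracket_def prod_eq_iff vec_eq_iff forall_3 cross3_def divide_simps)
      (simp add: algebra_simps rr)
qed

section \<open>The Levi-Civita connection in the frame\<close>

lemma k_smooth_on_subset: "k_smooth_on k S f \<Longrightarrow> T \<subseteq> S \<Longrightarrow> k_smooth_on k T f"
  by (induction k arbitrary: f) (auto intro: continuous_on_subset)

lemma smooth_on_mono: "smooth_on S f \<Longrightarrow> T \<subseteq> S \<Longrightarrow> smooth_on T f"
  unfolding smooth_on_def using k_smooth_on_subset by blast

lemma k_smooth_on_const: "k_smooth_on k S (\<lambda>_. c)"
  by (induction k arbitrary: c) (auto simp: frechet_derivative_const)

lemma smooth_on_bounded_linear: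
  assumes "bounded_linear f"
  shows "smooth_on S f"
proof -
  have "k_smooth_on k S f" for k
  proof (cases k)
    case (Suc j)
    have "frechet_derivative f (at x) = f" for x
      using bounded_linear_imp_has_derivative[OF assms, of "at x"] by (rule frechet_derivative_at[symmetric])
    then show ?thesis
      by (simp add: Suc bounded_linear_imp_differentiable[OF assms] k_smooth_on_const)
  qed (simp add: assms linear_continuous_on)
  then show ?thesis by (simp add: smooth_on_def)
qed

lemma smooth_on_has_derivative:
  assumes "smooth_on S f" "x \<in> S"
  shows "(f has_derivative frechet_derivative f (at x)) (at x)"
  using assms(1)[unfolded smooth_on_def, rule_format, of 1] assms(2) frechet_derivative_works by auto

lemma smooth_on_has_derivative2:
  assumes "smooth_on S f" "x \<in> S"
  shows "((\<lambda>y. frechet_derivative f (at y) v) has_derivative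
      frechet_derivative (\<lambda>y. frechet_derivative f (at y) v) (at x)) (at x)"
proof -
  have "(\<lambda>y. frechet_derivative f (at y) v) differentiable (at x)"
    using assms(1)[unfolded smooth_on_def, rule_format, of 2] assms(2) by (simp add: numeral_2_eq_2)
  then show ?thesis by (simp only: frechet_derivative_works)
qed

lemma vector_field_frame: "vector_field (\<lambda>x. frame x c)"
proof -
  have "bounded_linear (\<lambda>x. frame x c)"
    by (rule bounded_bilinear.bounded_linear_left[OF bounded_bilinear_frame])
  then have "smooth_on UNIV (\<lambda>x. frame x c)" by (rule smooth_on_bounded_linear)
  then have "smooth_on_subset S3S3 (\<lambda>x. frame x c)"
    unfolding smooth_on_subset_def using open_UNIV by blast
  then show ?thesis by (simp add: vector_field_def frame_tangent)
qed

lemma vector_field_coords_differentiable: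
  assumes "vector_field X" "x \<in> S3S3"
  shows "(\<lambda>y. coords y (X y)) differentiable (at x within S3S3)"
proof -
  obtain U h where U: "open U" "x \<in> U" "smooth_on U h" "\<And>y. y \<in> U \<inter> S3S3 \<Longrightarrow> h y = X y"
    using assms unfolding vector_field_def smooth_on_subset_def by blast
  obtain e where e: "e > 0" "ball x e \<subseteq> U" using U openE by blast
  have "(h has_derivative frechet_derivative h (at x)) (at x within S3S3)"
    using smooth_on_has_derivative[OF U(3,2)] by (rule has_derivative_at_withinI)
  then have "((\<lambda>y. coords y (h y)) has_derivative
      (\<lambda>v. coords x (frechet_derivative h (at x) v) + coords v (h x))) (at x within S3S3)"
    by (intro bounded_bilinear.FDERIV[OF bounded_bilinear_coords] has_derivative_ident)
  then have "((\<lambda>y. coords y (X y)) has_derivative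
      (\<lambda>v. coords x (frechet_derivative h (at x) v) + coords v (h x))) (at x within S3S3)"
  proof (rule has_derivative_transform_within[OF _ e(1) assms(2)])
    fix y assume "y \<in> S3S3" "dist y x < e"
    then show "coords y (h y) = coords y (X y)"
      using U(4)[of y] e(2)[THEN subsetD, of y] by (simp add: dist_commute)
  qed
  then show ?thesis by (rule differentiableI)
qed

text \<open>Normalizing the straight line gives a curve in the sphere with prescribed velocity.\<close>

lemma sphere_curve:
  fixes p V :: "'a::real_inner"
  assumes "norm p = 1" "V \<bullet> p = 0"
  obtains \<gamma> :: "real \<Rightarrow> 'a"
    where "\<forall>t. norm (\<gamma> t) = 1" "\<gamma> 0 = p" "(\<gamma> has_derivative (\<lambda>t. t *\<^sub>R V)) (at 0)"
proof
  let ?\<gamma> = "\<lambda>t. (1 / sqrt (1 + t\<^sup>2 * (V \<bullet> V))) *\<^sub>R (p + t *\<^sub>R V)"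
  have pos: "1 + t\<^sup>2 * (V \<bullet> V) > 0" for t by (simp add: add_pos_nonneg)
  have "(norm (p + t *\<^sub>R V))\<^sup>2 = 1 + t\<^sup>2 * (V \<bullet> V)" for t
    unfolding power2_norm_eq_inner using assms
    by (simp add: inner_add_left inner_add_right norm_eq_1 inner_commute power2_eq_square)
  then have "norm (p + t *\<^sub>R V) = sqrt (1 + t\<^sup>2 * (V \<bullet> V))" for t by (metis norm_ge_zero real_sqrt_unique)
  then show "\<forall>t. norm (?\<gamma> t) = 1" using pos by (simp add: less_imp_le order_less_imp_not_eq2)
  show "?\<gamma> 0 = p" by simp
  show "(?\<gamma> has_derivative (\<lambda>t. t *\<^sub>R V)) (at 0)" by (auto intro!: derivative_eq_intros)
qed

text \<open>On tangent vectors a derivative within \<open>S3S3\<close> is computed along a curve inside \<open>S3S3\<close>, hence unique;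
  this is what makes \<open>dir_deriv\<close> obey the rules of calculus.\<close>

lemma derivative_within_S3S3_unique:
  fixes f :: "quat2 \<Rightarrow> 'b::real_normed_vector"
  assumes x: "x \<in> S3S3" and v: "v \<in> tangent_S3S3 x"
    and D: "(f has_derivative D) (at x within S3S3)" "(f has_derivative D') (at x within S3S3)"
  shows "D v = D' v"
proof -
  have unit: "norm (fst x) = 1" "norm (snd x) = 1" using x by (auto simp: S3S3_def)
  have orth: "fst v \<bullet> fst x = 0" "snd v \<bullet> snd x = 0" using v by (auto simp: tangent_S3S3_def)
  obtain \<gamma>1 where g1: "\<forall>t. norm (\<gamma>1 t) = 1" "\<gamma>1 0 = fst x" "(\<gamma>1 has_derivative (\<lambda>t. t *\<^sub>R fst v)) (at 0)"
    using sphere_curve[OF unit(1) orth(1)] .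
  obtain \<gamma>2 where g2: "\<forall>t. norm (\<gamma>2 t) = 1" "\<gamma>2 0 = snd x" "(\<gamma>2 has_derivative (\<lambda>t. t *\<^sub>R snd v)) (at 0)"
    using sphere_curve[OF unit(2) orth(2)] .
  define \<gamma> where "\<gamma> t = (\<gamma>1 t, \<gamma>2 t)" for t
  have g: "\<gamma> 0 = x" "range \<gamma> \<subseteq> S3S3" by (auto simp: \<gamma>_def g1 g2 S3S3_def)
  have dg: "(\<gamma> has_derivative (\<lambda>t. t *\<^sub>R v)) (at 0)"
    using has_derivative_Pair[OF g1(3) g2(3)] by (simp add: \<gamma>_def[abs_def] scaleR_prod_def)
  have "((\<lambda>t. f (\<gamma> t)) has_derivative (\<lambda>t. E (t *\<^sub>R v))) (at 0)"
    if "(f has_derivative E) (at x within S3S3)" for E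
    using has_derivative_in_compose[OF dg, of f E] has_derivative_subset[OF that g(2)] g(1) by simp
  from has_derivative_unique[OF this[OF D(1)] this[OF D(2)]] show ?thesis
    by (metis scaleR_one)
qed

lemma dir_deriv_eq:
  assumes "x \<in> S3S3" "v \<in> tangent_S3S3 x" "(f has_derivative D) (at x within S3S3)"
  shows "dir_deriv f x v = D v"
proof -
  have "(f has_derivative frechet_derivative f (at x within S3S3)) (at x within S3S3)"
    using assms(3) by (metis differentiableI frechet_derivative_works)
  then show ?thesis
    unfolding dir_deriv_def using derivative_within_S3S3_unique[OF assms(1,2) _ assms(3)] by blast
qed

lemma dir_deriv_vector_field:
  assumes X: "vector_field X" and x: "x \<in> S3S3" and v: "v \<in> tangent_S3S3 x"
    and D: "((\<lambda>y. coords y (X y)) has_derivative D) (at x within S3S3)"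
  shows "dir_deriv X x v = frame v (coords x (X x)) + frame x (D v)"
proof -
  have "((\<lambda>y. frame y (coords y (X y))) has_derivative
      (\<lambda>v. frame x (D v) + frame v (coords x (X x)))) (at x within S3S3)"
    by (intro bounded_bilinear.FDERIV[OF bounded_bilinear_frame] has_derivative_ident D)
  then have "(X has_derivative (\<lambda>v. frame x (D v) + frame v (coords x (X x)))) (at x within S3S3)"
    by (rule has_derivative_transform_within[OF _ zero_less_one x])
       (use X in \<open>auto simp: vector_field_def frame_coords\<close>)
  from dir_deriv_eq[OF x v this] show ?thesis by simp
qed

lemma lie_bracket_coords:
  assumes X: "vector_field X" and Y: "vector_field Y" and x: "x \<in> S3S3"
    and DX: "((\<lambda>y. coords y (X y)) has_derivative DX) (at x within S3S3)"
    and DY: "((\<lambda>y. coords y (Y y)) has_derivative DY) (at x within S3S3)"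
  shows "coords x (lie_bracket X Y x)
    = DY (X x) - DX (Y x) + bracket (coords x (X x)) (coords x (Y x))"
proof -
  have t: "X x \<in> tangent_S3S3 x" "Y x \<in> tangent_S3S3 x" using X Y x by (auto simp: vector_field_def)
  have "lie_bracket X Y x = (frame (X x) (coords x (Y x)) - frame (Y x) (coords x (X x)))
      + (frame x (DY (X x)) - frame x (DX (Y x)))"
    unfolding lie_bracket_def dir_deriv_vector_field[OF Y x t(1) DY] dir_deriv_vector_field[OF X x t(2) DX]
    by simp
  also have "frame (X x) (coords x (Y x)) - frame (Y x) (coords x (X x))
      = frame x (bracket (coords x (X x)) (coords x (Y x)))"
    using frame_frame[of x "coords x (X x)" "coords x (Y x)"] by (simp add: frame_coords x t)
  finally have "lie_bracket X Y x
      = frame x (DY (X x) - DX (Y x) + bracket (coords x (X x)) (coords x (Y x)))"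
    by (simp add: bilinear_radd[OF bilinear_frame] bilinear_rsub[OF bilinear_frame])
  then show ?thesis by (simp add: coords_frame[OF x])
qed

lemma metric_coords:
  assumes "x \<in> S3S3" "Z \<in> tangent_S3S3 x" "W \<in> tangent_S3S3 x"
  shows "g x Z W = 12 * (coords x Z \<bullet> coords x W)"
  using g_frame[OF assms(1), of "coords x Z" "coords x W"] by (simp add: frame_coords assms)

lemma dir_deriv_metric:
  assumes Y: "vector_field Y" and Z: "vector_field Z" and x: "x \<in> S3S3" and v: "v \<in> tangent_S3S3 x"
    and DY: "((\<lambda>y. coords y (Y y)) has_derivative DY) (at x within S3S3)"
    and DZ: "((\<lambda>y. coords y (Z y)) has_derivative DZ) (at x within S3S3)"
  shows "dir_deriv (\<lambda>y. g y (Y y) (Z y)) x v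
    = 12 * (DY v \<bullet> coords x (Z x) + coords x (Y x) \<bullet> DZ v)"
proof -
  have "((\<lambda>y. 12 * (coords y (Y y) \<bullet> coords y (Z y))) has_derivative
     (\<lambda>v. 12 * (coords x (Y x) \<bullet> DZ v + DY v \<bullet> coords x (Z x)))) (at x within S3S3)"
    by (intro has_derivative_mult_right has_derivative_inner DY DZ)
  then have "((\<lambda>y. g y (Y y) (Z y)) has_derivative
     (\<lambda>v. 12 * (coords x (Y x) \<bullet> DZ v + DY v \<bullet> coords x (Z x)))) (at x within S3S3)"
    by (rule has_derivative_transform_within[OF _ zero_less_one x])
       (use Y Z in \<open>auto simp: vector_field_def metric_coords\<close>)
  from dir_deriv_eq[OF x v this] show ?thesis by simp
qed

text \<open>Koszul's argument with a left-invariant third field \<open>Z\<close>, whose coordinates are constant: the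
  sum of two metric equations minus the third, with torsion used to interchange arguments, leaves \<open>dY(X)\<close> and a
  combination of brackets, which is \<open>christoffel\<close>.\<close>

lemma levi_civita_coords:
  assumes lc: "levi_civita nabla" and X: "vector_field X" and Y: "vector_field Y" and x: "x \<in> S3S3"
    and DY: "((\<lambda>y. coords y (Y y)) has_derivative DY) (at x within S3S3)"
  shows "coords x (nabla X Y x) = DY (X x) + christoffel (coords x (X x)) (coords x (Y x))"
proof -
  have vf: "vector_field (nabla A B)" if "vector_field A" "vector_field B" for A B
    using lc[unfolded levi_civita_def affine_connection_def, THEN conjunct1, THEN conjunct1] that by simp
  have tan: "A x \<in> tangent_S3S3 x" if "vector_field A" for A
    using that x by (simp add: vector_field_def)
  have torsion: "coords x (nabla A B x) - coords x (nabla B A x) = coords x (lie_bracket A B x)"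
    if "vector_field A" "vector_field B" for A B
  proof -
    have "nabla A B x - nabla B A x = lie_bracket A B x"
      using lc[unfolded levi_civita_def, THEN conjunct2, THEN conjunct1] that x by simp
    then show ?thesis by (metis bilinear_rsub[OF bilinear_coords])
  qed
  have metric: "DB (A x) \<bullet> coords x (C x) + coords x (B x) \<bullet> DC (A x)
      = coords x (nabla A B x) \<bullet> coords x (C x) + coords x (B x) \<bullet> coords x (nabla A C x)"
    if A: "vector_field A" and B: "vector_field B" and C: "vector_field C"
      and DB: "((\<lambda>y. coords y (B y)) has_derivative DB) (at x within S3S3)"
      and DC: "((\<lambda>y. coords y (C y)) has_derivative DC) (at x within S3S3)" for A B C DB DC
  proof -
    have "dir_deriv (\<lambda>y. g y (B y) (C y)) x (A x)
        = g x (nabla A B x) (C x) + g x (B x) (nabla A C x)"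
      using lc[unfolded levi_civita_def, THEN conjunct2, THEN conjunct2] A B C x by simp
    then show ?thesis
      unfolding dir_deriv_metric[OF B C x tan[OF A] DB DC]
      by (simp add: metric_coords x tan vf A B C)
  qed
  obtain DX where DX: "((\<lambda>y. coords y (X y)) has_derivative DX) (at x within S3S3)"
    using vector_field_coords_differentiable[OF X x] unfolding differentiable_def by blast
  show ?thesis
  proof (rule vector_eq_rdot[THEN iffD1], rule allI)
    fix c
    define Z where "Z = (\<lambda>y. frame y c)"
    have Z: "vector_field Z" unfolding Z_def by (rule vector_field_frame)
    have zc: "coords x (Z x) = c" by (simp add: Z_def coords_frame x)
    have DZ: "((\<lambda>y. coords y (Z y)) has_derivative (\<lambda>_. 0)) (at x within S3S3)"
      by (rule has_derivative_transform_within[OF has_derivative_const[of c] zero_less_one x])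
         (simp add: Z_def coords_frame)
    note m1 = metric[OF X Y Z DY DZ, unfolded zc] and m2 = metric[OF Y X Z DX DZ, unfolded zc]
      and m3 = metric[OF Z X Y DX DY]
    note t1 = torsion[OF X Y, unfolded lie_bracket_coords[OF X Y x DX DY]]
      and t2 = torsion[OF X Z, unfolded lie_bracket_coords[OF X Z x DX DZ] zc]
      and t3 = torsion[OF Y Z, unfolded lie_bracket_coords[OF Y Z x DY DZ] zc]
    from t1 t2 t3 have "coords x (nabla Y X x) = coords x (nabla X Y x) - (DY (X x) - DX (Y x) + bracket (coords x (X x)) (coords x (Y x)))"
      "coords x (nabla Z X x) = coords x (nabla X Z x) + DX (Z x) - bracket (coords x (X x)) c"
      "coords x (nabla Z Y x) = coords x (nabla Y Z x) + DY (Z x) - bracket (coords x (Y x)) c"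
      by (simp_all add: algebra_simps)
    then show "coords x (nabla X Y x) \<bullet> c = (DY (X x) + christoffel (coords x (X x)) (coords x (Y x))) \<bullet> c"
      using m1 m2 m3 christoffel_koszul[of "coords x (X x)" "coords x (Y x)" c]
      by (simp add: inner_add_left inner_add_right inner_diff_left inner_diff_right inner_commute)
  qed
qed

section \<open>Hypersurfaces in a chart\<close>

lemma derivative_tangent_S3S3:
  fixes f :: "'a::real_normed_vector \<Rightarrow> quat2"
  assumes U: "open U" "x \<in> U" and f: "\<And>y. y \<in> U \<Longrightarrow> f y \<in> S3S3" and D: "(f has_derivative D) (at x)"
  shows "D v \<in> tangent_S3S3 (f x)"
proof -
  have 1: "fst (f y) \<bullet> fst (f y) = 1" "snd (f y) \<bullet> snd (f y) = 1" if "y \<in> U" for y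
    using f[OF that] by (auto simp: S3S3_def norm_eq_1)
  have "fst (f x) \<bullet> fst (D v) + fst (D v) \<bullet> fst (f x) = 0"
    using derivative_of_constant_on_open[OF U 1(1)
        has_derivative_inner[OF has_derivative_fst[OF D] has_derivative_fst[OF D]], of v] by simp
  moreover have "snd (f x) \<bullet> snd (D v) + snd (D v) \<bullet> snd (f x) = 0"
    using derivative_of_constant_on_open[OF U 1(2)
        has_derivative_inner[OF has_derivative_snd[OF D] has_derivative_snd[OF D]], of v] by simp
  ultimately show ?thesis by (simp add: tangent_S3S3_def case_prod_unfold inner_commute)
qed

text \<open>Both sides have dimension 5, since the frame coordinates have dimension 6.\<close>

lemma injective_into_hyperplane:
  fixes h :: "real^5 \<Rightarrow> frame_coords"
  assumes "linear h" "inj h" "a \<noteq> 0" "\<And>v. a \<bullet> h v = 0"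
  shows "range h = {c. a \<bullet> c = 0}"
proof (rule subspace_dim_equal)
  show "subspace (range h)" by (simp add: linear_subspace_image[OF assms(1)])
  show "subspace {c. a \<bullet> c = 0}" by (rule subspace_hyperplane)
  show "range h \<subseteq> {c. a \<bullet> c = 0}" using assms(4) by auto
  have "dim (range h) = dim (UNIV :: (real^5) set)"
    using dim_image_eq[OF assms(1), of UNIV] assms(2) by simp
  then show "dim {c. a \<bullet> c = 0} \<le> dim (range h)"
    by (simp add: dim_hyperplane[OF assms(3)])
qed

lemma open_chart_image:
  assumes "smooth_manifold M \<A>" "(U, c) \<in> \<A>" "openin M W"
  shows "open (c ` (U \<inter> W))"
proof -
  have c: "openin M U" "open (c ` U)" "homeomorphic_map (subtopology M U) (top_of_set (c ` U)) c"
    using assms(1,2) by (auto simp: smooth_manifold_def)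
  have "openin (subtopology M U) (U \<inter> W)"
    using assms(3) by (auto simp: openin_subtopology)
  then have "openin (top_of_set (c ` U)) (c ` (U \<inter> W))"
    using homeomorphic_imp_open_map[OF c(3)] by (simp add: open_map_def)
  then show ?thesis using c(2) by (simp add: openin_open_eq)
qed

lemma chart_inj:
  assumes "smooth_manifold M \<A>" "(U, c) \<in> \<A>"
  shows "inj_on c U" "U \<subseteq> topspace M"
proof -
  have c: "openin M U" "homeomorphic_map (subtopology M U) (top_of_set (c ` U)) c"
    using assms by (auto simp: smooth_manifold_def)
  show "U \<subseteq> topspace M" using c(1) by (rule openin_subset)
  then show "inj_on c U" using homeomorphic_imp_injective_map[OF c(2)] by (simp add: Int_absorb1)
qed

lemma chart_around:
  assumes "smooth_manifold M \<A>" "x \<in> topspace M"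
  obtains U c where "(U, c) \<in> \<A>" "x \<in> U"
proof -
  have "x \<in> (\<Union>(U, c)\<in>\<A>. U)" using assms by (simp add: smooth_manifold_def)
  then show thesis using that by auto
qed

text \<open>The range of the differential in one chart is contained in the orthogonal complement of the normal
  and has the same dimension. Hence all charts define the same tangent space, and no transition maps
  enter.\<close>

lemma tangent_hyp_eq:
  assumes imm: "immersed_hypersurface M \<A> F" and V: "openin M V" and un: "unit_normal_on \<A> F V \<xi>"
    and x: "x \<in> V"
  shows "tangent_hyp \<A> F x = {w \<in> tangent_S3S3 (F x). g (F x) (\<xi> x) w = 0}"
    and "(U, c) \<in> \<A> \<Longrightarrow> x \<in> U \<Longrightarrow>
      range (frechet_derivative (F \<circ> inv_into U c) (at (c x))) = tangent_hyp \<A> F x"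
proof -
  let ?T = "{w \<in> tangent_S3S3 (F x). g (F x) (\<xi> x) w = 0}"
  have sm: "smooth_manifold M \<A>" and smF: "smooth_map_on \<A> (topspace M) F"
    and FS: "\<And>y. y \<in> topspace M \<Longrightarrow> F y \<in> S3S3"
    and inj: "\<And>U c y. (U, c) \<in> \<A> \<Longrightarrow> y \<in> U \<Longrightarrow> inj (frechet_derivative (F \<circ> inv_into U c) (at (c y)))"
    using imm by (auto simp: immersed_hypersurface_def)
  have xM: "x \<in> topspace M" using V x openin_subset by blast
  have Fx: "F x \<in> S3S3" by (rule FS[OF xM])
  have n: "\<xi> x \<in> tangent_S3S3 (F x)" "g (F x) (\<xi> x) (\<xi> x) = 1"
    "\<And>w. w \<in> tangent_hyp \<A> F x \<Longrightarrow> g (F x) (\<xi> x) w = 0"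
    using un x by (auto simp: unit_normal_on_def)
  have range_eq: "range (frechet_derivative (F \<circ> inv_into U c) (at (c x))) = ?T"
    if Uc: "(U, c) \<in> \<A>" and xU: "x \<in> U" for U c
  proof -
    let ?f = "F \<circ> inv_into U c"
    define D where "D = frechet_derivative ?f (at (c x))"
    have inv: "inv_into U c (c x) = x" using chart_inj[OF sm Uc] xU by simp
    have op: "open (c ` U)" using sm Uc by (auto simp: smooth_manifold_def)
    have "smooth_on (c ` (U \<inter> topspace M)) ?f" using smF Uc by (auto simp: smooth_map_on_def)
    then have "smooth_on (c ` U) ?f" using chart_inj(2)[OF sm Uc] by (simp add: Int_absorb2)
    then have D: "(?f has_derivative D) (at (c x))"
      unfolding D_def by (rule smooth_on_has_derivative) (use xU in blast)
    have fS: "?f y \<in> S3S3" if "y \<in> c ` U" for y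
      using FS chart_inj(2)[OF sm Uc] inv_into_into[OF that] by auto
    have tan: "D v \<in> tangent_S3S3 (F x)" for v
      using derivative_tangent_S3S3[OF op _ fS D] xU by (auto simp: inv)
    have orth: "g (F x) (\<xi> x) (D v) = 0" for v
      by (rule n(3)) (use Uc xU in \<open>auto simp: tangent_hyp_def D_def\<close>)
    let ?h = "\<lambda>v. coords (F x) (D v)"
    have lin: "linear ?h"
      by (rule bounded_linear.linear[OF bounded_linear_compose[OF
          bounded_bilinear.bounded_linear_right[OF bounded_bilinear_coords] has_derivative_bounded_linear[OF D]]])
    have "inj ?h"
    proof (rule injI)
      fix v w assume "?h v = ?h w"
      then have "D v = D w" by (metis frame_coords[OF Fx tan])
      then show "v = w" using inj[OF Uc xU] by (simp add: D_def inj_eq)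
    qed
    moreover have "coords (F x) (\<xi> x) \<noteq> 0"
      using n(2) metric_coords[OF Fx n(1) n(1)] by auto
    moreover have "coords (F x) (\<xi> x) \<bullet> ?h v = 0" for v
      using orth[of v] metric_coords[OF Fx n(1) tan] by simp
    ultimately have rh: "range ?h = {c. coords (F x) (\<xi> x) \<bullet> c = 0}"
      by (rule injective_into_hyperplane[OF lin])
    show ?thesis
    proof
      show "range (frechet_derivative ?f (at (c x))) \<subseteq> ?T"
        using tan orth by (auto simp: D_def)
      show "?T \<subseteq> range (frechet_derivative ?f (at (c x)))"
      proof
        fix w assume w: "w \<in> ?T"
        then have "coords (F x) w \<in> range ?h"
          using metric_coords[OF Fx n(1), of w] by (simp add: rh)
        then obtain v where "coords (F x) w = coords (F x) (D v)" by blast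
        then have "w = D v" using w tan frame_coords[OF Fx] by (metis (mono_tags, lifting) mem_Collect_eq)
        then show "w \<in> range (frechet_derivative ?f (at (c x)))" by (simp add: D_def)
      qed
    qed
  qed
  have "tangent_hyp \<A> F x = (\<Union>p\<in>{(U, c) \<in> \<A>. x \<in> U}. ?T)"
    unfolding tangent_hyp_def by (rule SUP_cong[OF refl]) (clarify, rule range_eq)
  moreover obtain U0 c0 where "(U0, c0) \<in> \<A>" "x \<in> U0" using chart_around[OF sm xM] .
  then have "{(U, c) \<in> \<A>. x \<in> U} \<noteq> {}" by blast
  ultimately show *: "tangent_hyp \<A> F x = ?T" by (simp only: UN_constant if_False)
  show "range (frechet_derivative (F \<circ> inv_into U c) (at (c x))) = tangent_hyp \<A> F x"
    if "(U, c) \<in> \<A>" "x \<in> U"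
    unfolding * by (rule range_eq[OF that])
qed

text \<open>The normal is \<open>frame (F x) \<nu> / sqrt 12\<close> because \<open>g\<close> is 12 times the standard inner product in the frame.\<close>

lemma phi_frame:
  assumes x: "F x \<in> S3S3" and th: "tangent_hyp \<A> F x = {w \<in> tangent_S3S3 (F x). g (F x) (\<xi> x) w = 0}"
    and \<xi>: "\<xi> x = frame (F x) ((1 / sqrt 12) *\<^sub>R \<nu>)" and \<nu>: "\<nu> \<bullet> \<nu> = 1"
  shows "phi \<A> F \<xi> x (frame (F x) c) = frame (F x) (Jc c - (Jc c \<bullet> \<nu>) *\<^sub>R \<nu>)"
  unfolding phi_def
proof (rule the_equality)
  have sub: "frame (F x) X - frame (F x) Y = frame (F x) (X - Y)" 
    "a *\<^sub>R frame (F x) X = frame (F x) (a *\<^sub>R X)"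
    "frame (F x) X + frame (F x) Y = frame (F x) (X + Y)" for X Y a
    by (simp_all add: bilinear_rsub[OF bilinear_frame] bilinear_rmul[OF bilinear_frame] bilinear_radd[OF bilinear_frame])
  have gx: "g (F x) (\<xi> x) (frame (F x) X) = sqrt 12 * (\<nu> \<bullet> X)" for X
    unfolding \<xi> g_frame[OF x] using real_div_sqrt[of 12]
    by (simp add: times_divide_eq_left[symmetric] del: times_divide_eq_left)
  show "frame (F x) (Jc c - (Jc c \<bullet> \<nu>) *\<^sub>R \<nu>) \<in> tangent_hyp \<A> F x \<and>
    (\<exists>a. J (F x) (frame (F x) c) = frame (F x) (Jc c - (Jc c \<bullet> \<nu>) *\<^sub>R \<nu>) + a *\<^sub>R \<xi> x)"
  proof (intro conjI exI[of _ "sqrt 12 * (Jc c \<bullet> \<nu>)"])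
    show "frame (F x) (Jc c - (Jc c \<bullet> \<nu>) *\<^sub>R \<nu>) \<in> tangent_hyp \<A> F x"
      unfolding th by (simp add: frame_tangent gx inner_diff_right \<nu> inner_commute)
    show "J (F x) (frame (F x) c)
        = frame (F x) (Jc c - (Jc c \<bullet> \<nu>) *\<^sub>R \<nu>) + (sqrt 12 * (Jc c \<bullet> \<nu>)) *\<^sub>R \<xi> x"
      by (simp add: J_frame[OF x] \<xi> sub)
  qed
  fix t assume t: "t \<in> tangent_hyp \<A> F x \<and> (\<exists>a. J (F x) (frame (F x) c) = t + a *\<^sub>R \<xi> x)"
  then obtain a where a: "J (F x) (frame (F x) c) = t + a *\<^sub>R \<xi> x" by blast
  have tf: "t = frame (F x) (Jc c - (a / sqrt 12) *\<^sub>R \<nu>)"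
    using a unfolding J_frame[OF x] \<xi> sub(2) sub(1)[symmetric] by (simp add: eq_diff_eq)
  moreover have "g (F x) (\<xi> x) t = 0" using t th by blast
  ultimately have "a / sqrt 12 = Jc c \<bullet> \<nu>" by (simp add: gx inner_diff_right \<nu> inner_commute)
  with tf show "t = frame (F x) (Jc c - (Jc c \<bullet> \<nu>) *\<^sub>R \<nu>)" by simp
qed

text \<open>The chart data satisfy the axioms of \<open>anticommuting_patch\<close>. The structure equation of the shape operator
  comes from \<open>levi_civita_coords\<close>: an extension \<open>Y\<close> of the normal field agrees with it along the
  immersion, so by the chain rule the derivative of the coordinates of \<open>Y\<close> is the derivative of \<open>n\<close>.\<close>

lemma chart_domain_empty:
  fixes \<A> :: "('m, real^5) chart set" and F :: "'m \<Rightarrow> quat2"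
  assumes lc: "levi_civita nabla" and imm: "immersed_hypersurface M \<A> F"
    and V: "openin M V" and un: "unit_normal_on \<A> F V \<xi>"
    and so: "shape_operator_on nabla M \<A> F V \<xi> A"
    and anti: "\<And>y w. y \<in> V \<Longrightarrow> w \<in> tangent_hyp \<A> F y \<Longrightarrow>
       A y (phi \<A> F \<xi> y w) + phi \<A> F \<xi> y (A y w) = 0"
    and Uc: "(U, c) \<in> \<A>"
  shows "c ` (U \<inter> V) = {}"
proof -
  have sm: "smooth_manifold M \<A>" and smF: "smooth_map_on \<A> (topspace M) F"
    and FS: "\<And>y. y \<in> topspace M \<Longrightarrow> F y \<in> S3S3"
    using imm by (auto simp: immersed_hypersurface_def)
  define \<psi> where "\<psi> = inv_into U c"
  define \<Omega> where "\<Omega> = c ` (U \<inter> V)"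
  have op: "open \<Omega>" unfolding \<Omega>_def by (rule open_chart_image[OF sm Uc V])
  have \<psi>: "\<psi> y \<in> U" "\<psi> y \<in> V" "c (\<psi> y) = y" if "y \<in> \<Omega>" for y
    using that chart_inj(1)[OF sm Uc] by (auto simp: \<Omega>_def \<psi>_def inv_into_f_f)
  define f where "f = F \<circ> \<psi>"
  define m where "m = \<xi> \<circ> \<psi>"
  have fS: "f y \<in> S3S3" if "y \<in> \<Omega>" for y
    using FS V \<psi>(2)[OF that] openin_subset unfolding f_def by fastforce
  have sf: "smooth_on \<Omega> f"
  proof (rule smooth_on_mono)
    show "smooth_on (c ` (U \<inter> topspace M)) f"
      using smF Uc by (auto simp: smooth_map_on_def f_def \<psi>_def)
    show "\<Omega> \<subseteq> c ` (U \<inter> topspace M)" using openin_subset[OF V] by (auto simp: \<Omega>_def)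
  qed
  have smo: "smooth_on \<Omega> m"
    using un Uc by (auto simp: unit_normal_on_def smooth_map_on_def \<Omega>_def m_def \<psi>_def)
  define f' where "f' y = frechet_derivative f (at y)" for y
  define m' where "m' y = frechet_derivative m (at y)" for y
  define f'' where "f'' x v = frechet_derivative (\<lambda>y. f' y v) (at x)" for x v
  define m'' where "m'' x v = frechet_derivative (\<lambda>y. m' y v) (at x)" for x v
  have df: "(f has_derivative f' y) (at y)" and dm: "(m has_derivative m' y) (at y)"
    and ddf: "((\<lambda>y. f' y v) has_derivative f'' y v) (at y)"
    and ddm: "((\<lambda>y. m' y v) has_derivative m'' y v) (at y)" if "y \<in> \<Omega>" for y v
    unfolding f'_def m'_def f''_def m''_def
    using smooth_on_has_derivative[OF sf that] smooth_on_has_derivative[OF smo that]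
      smooth_on_has_derivative2[OF sf that] smooth_on_has_derivative2[OF smo that] by auto
  have symf: "f'' y v w = f'' y w v" and symm: "m'' y v w = m'' y w v" if "y \<in> \<Omega>" for y v w
    using mixed_derivatives_commute[OF op that df ddf[OF that] ddf[OF that]]
      mixed_derivatives_commute[OF op that dm ddm[OF that] ddm[OF that]] by blast+
  have tan: "f' y v \<in> tangent_S3S3 (f y)" if "y \<in> \<Omega>" for y v
    by (rule derivative_tangent_S3S3[OF op that fS df[OF that]])
  (* The frame has length sqrt 12, so this factor turns the coordinates of the unit normal into a unit
     vector. *)
  define \<kappa> where "\<kappa> = sqrt 12"
  have \<kappa>: "\<kappa> > 0" "\<kappa> * \<kappa> = 12" by (simp_all add: \<kappa>_def)
  define n where "n y = \<kappa> *\<^sub>R coords (f y) (m y)" for y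
  define n' where "n' y v = \<kappa> *\<^sub>R (coords (f y) (m' y v) + coords (f' y v) (m y))" for y v
  define n'' where "n'' y v w = \<kappa> *\<^sub>R ((coords (f y) (m'' y v w) + coords (f' y w) (m' y v))
      + (coords (f' y v) (m' y w) + coords (f'' y v w) (m y)))" for y v w
  define \<omega> where "\<omega> y v = coords (f y) (f' y v)" for y v
  define \<omega>' where "\<omega>' y v w = coords (f y) (f'' y v w) + coords (f' y w) (f' y v)" for y v w
  define S where "S y d = \<kappa> *\<^sub>R coords (f y) (A (\<psi> y) (frame (f y) d))" for y d
  have f'_frame: "f' y v = frame (f y) (\<omega> y v)" if "y \<in> \<Omega>" for y v
    by (simp add: \<omega>_def frame_coords[OF fS[OF that] tan[OF that]])
  have F\<psi>: "F (\<psi> y) = f y" "\<xi> (\<psi> y) = m y" for y by (simp_all add: f_def m_def)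
  have th: "tangent_hyp \<A> F (\<psi> y) = {w \<in> tangent_S3S3 (f y). g (f y) (m y) w = 0}" if "y \<in> \<Omega>" for y
    using tangent_hyp_eq(1)[OF imm V un \<psi>(2)[OF that]] by (simp add: F\<psi>)
  have th_range: "tangent_hyp \<A> F (\<psi> y) = range (f' y)" if "y \<in> \<Omega>" for y
    using tangent_hyp_eq(2)[OF imm V un \<psi>(2)[OF that] Uc \<psi>(1)[OF that]] \<psi>(3)[OF that]
    by (simp add: f'_def f_def \<psi>_def)
  have mt: "m y \<in> tangent_S3S3 (f y)" "g (f y) (m y) (m y) = 1" if "y \<in> \<Omega>" for y
    using un \<psi>(2)[OF that] by (auto simp: unit_normal_on_def m_def f_def)
  have m_frame: "m y = frame (f y) ((1 / sqrt 12) *\<^sub>R n y)" if "y \<in> \<Omega>" for y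
    using \<kappa> by (simp add: n_def \<kappa>_def[symmetric] frame_coords fS mt that)
  have unit: "n y \<bullet> n y = 1" if "y \<in> \<Omega>" for y
    using mt(2)[OF that] metric_coords[OF fS[OF that] mt(1)[OF that] mt(1)[OF that]] \<kappa>
    by (simp add: n_def mult.assoc[symmetric])
  have g_n: "g (f y) (m y) (frame (f y) d) = \<kappa> * (n y \<bullet> d)" if "y \<in> \<Omega>" for y d
    using metric_coords[OF fS[OF that] mt(1)[OF that] frame_tangent] \<kappa>
    by (simp add: coords_frame fS that n_def mult.assoc[symmetric])
  have th_frame: "frame (f y) d \<in> tangent_hyp \<A> F (\<psi> y) \<longleftrightarrow> n y \<bullet> d = 0" if "y \<in> \<Omega>" for y d
    using \<kappa> by (simp add: th that frame_tangent g_n)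
  interpret anticommuting_patch \<Omega> \<omega> \<omega>' n n' n'' S
  proof
    show "open \<Omega>" by (rule op)
  next
    fix x v assume x: "x \<in> \<Omega>"
    show "((\<lambda>y. \<omega> y v) has_derivative \<omega>' x v) (at x)"
      unfolding \<omega>_def \<omega>'_def by (intro bounded_bilinear.FDERIV[OF bounded_bilinear_coords] df ddf x)
    show "(n has_derivative n' x) (at x)"
      unfolding n_def[abs_def] n'_def[abs_def]
      by (intro has_derivative_scaleR_right bounded_bilinear.FDERIV[OF bounded_bilinear_coords] df dm x)
    show "((\<lambda>y. n' y v) has_derivative n'' x v) (at x)"
      unfolding n'_def n''_def
      by (intro has_derivative_scaleR_right has_derivative_add
          bounded_bilinear.FDERIV[OF bounded_bilinear_coords] df dm ddf ddm x)
  next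
    fix x v w assume x: "x \<in> \<Omega>"
    show "\<omega>' x v w - \<omega>' x w v = bracket (\<omega> x v) (\<omega> x w)"
      using coords_frame_frame[OF fS[OF x], of "\<omega> x w" "\<omega> x v"]
      by (simp add: \<omega>'_def symf[OF x, of v w] f'_frame[OF x, symmetric])
    show "n'' x v w = n'' x w v"
      by (simp add: n''_def symf[OF x, of v w] symm[OF x, of v w])
  next
    fix x assume x: "x \<in> \<Omega>"
    show "n x \<bullet> n x = 1" by (rule unit[OF x])
    have ortho: "n x \<bullet> \<omega> x v = 0" for v
    proof -
      have "frame (f x) (\<omega> x v) \<in> tangent_hyp \<A> F (\<psi> x)"
        unfolding th_range[OF x] f'_frame[OF x, symmetric] by (rule rangeI)
      then show ?thesis by (simp only: th_frame[OF x])
    qed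
    show "range (\<omega> x) = {c. n x \<bullet> c = 0}"
    proof
      show "range (\<omega> x) \<subseteq> {c. n x \<bullet> c = 0}"
        using ortho by auto
      show "{c. n x \<bullet> c = 0} \<subseteq> range (\<omega> x)"
      proof
        fix d assume "d \<in> {c. n x \<bullet> c = 0}"
        then obtain v where "frame (f x) d = f' x v"
          using th_frame[OF x, of d] th_range[OF x] by auto
        then have "d = \<omega> x v" by (metis \<omega>_def coords_frame fS x)
        then show "d \<in> range (\<omega> x)" by blast
      qed
    qed
  next
    fix x v assume x: "x \<in> \<Omega>"
    have w: "f' x v \<in> tangent_hyp \<A> F (\<psi> x)" by (simp add: th_range[OF x])
    then have "covariant_deriv_along nabla M F \<xi> (\<psi> x) (f' x v) (- A (\<psi> x) (f' x v))"
      using so \<psi>(2)[OF x] by (simp add: shape_operator_on_def)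
    then obtain X Y W where X: "vector_field X" and Y: "vector_field Y" and Xx: "X (f x) = f' x v"
      and W: "openin M W" "\<psi> x \<in> W" and YW: "\<And>y. y \<in> W \<Longrightarrow> Y (F y) = \<xi> y"
      and nab: "- A (\<psi> x) (f' x v) = nabla X Y (f x)"
      unfolding covariant_deriv_along_def F\<psi> by blast
    obtain D where D: "((\<lambda>y. coords y (Y y)) has_derivative D) (at (f x) within S3S3)"
      using vector_field_coords_differentiable[OF Y fS[OF x]] unfolding differentiable_def by blast
    define \<Omega>' where "\<Omega>' = c ` (U \<inter> W) \<inter> \<Omega>"
    have op': "open \<Omega>'" unfolding \<Omega>'_def
      by (intro open_Int open_chart_image[OF sm Uc W(1)] op)
    have x': "x \<in> \<Omega>'" unfolding \<Omega>'_def using x W(2) \<psi>[OF x] by (metis IntI image_eqI)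
    have Ym: "Y (f y) = m y" if "y \<in> \<Omega>'" for y
    proof -
      have "\<psi> y \<in> W" using that chart_inj(1)[OF sm Uc] by (auto simp: \<Omega>'_def \<psi>_def)
      from YW[OF this] show ?thesis by (simp add: F\<psi>)
    qed
    have "(f has_derivative f' x) (at x within \<Omega>')" using df[OF x] by (rule has_derivative_at_withinI)
    moreover have "f ` \<Omega>' \<subseteq> S3S3" using fS by (auto simp: \<Omega>'_def)
    ultimately have "((\<lambda>y. coords (f y) (Y (f y))) has_derivative (\<lambda>v. D (f' x v))) (at x within \<Omega>')"
      using has_derivative_in_compose[of f "f' x" x \<Omega>' "\<lambda>y. coords y (Y y)" D] has_derivative_subset[OF D]
      by simp
    then have "((\<lambda>y. coords (f y) (Y (f y))) has_derivative (\<lambda>v. D (f' x v))) (at x)"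
      using at_within_open[OF x' op'] by simp
    then have d1: "((\<lambda>y. coords (f y) (m y)) has_derivative (\<lambda>v. D (f' x v))) (at x)"
      by (rule has_derivative_transform_within_open[OF _ op' x']) (simp add: Ym)
    have d2: "((\<lambda>y. coords (f y) (m y)) has_derivative
        (\<lambda>v. coords (f x) (m' x v) + coords (f' x v) (m x))) (at x)"
      by (intro bounded_bilinear.FDERIV[OF bounded_bilinear_coords] df dm x)
    have "D (f' x v) = coords (f x) (m' x v) + coords (f' x v) (m x)"
      by (rule fun_cong[OF has_derivative_unique[OF d1 d2]])
    moreover have "coords (f x) (- A (\<psi> x) (f' x v)) = D (f' x v) + christoffel (\<omega> x v) (coords (f x) (m x))"
      unfolding nab levi_civita_coords[OF lc X Y fS[OF x] D] by (simp add: Xx \<omega>_def Ym[OF x'])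
    moreover have "christoffel (\<omega> x v) (n x) = \<kappa> *\<^sub>R christoffel (\<omega> x v) (coords (f x) (m x))"
      by (simp add: n_def bilinear_rmul[OF bilinear_christoffel])
    moreover have "S x (\<omega> x v) = - (\<kappa> *\<^sub>R coords (f x) (- A (\<psi> x) (f' x v)))"
      by (simp add: S_def f'_frame[OF x, symmetric] bilinear_rneg[OF bilinear_coords])
    ultimately show "n' x v + christoffel (\<omega> x v) (n x) = - S x (\<omega> x v)"
      by (simp add: n'_def scaleR_add_right)
  next
    fix x d assume x: "x \<in> \<Omega>" and d: "n x \<bullet> d = 0"
    let ?\<phi> = "\<lambda>c. Jc c - (Jc c \<bullet> n x) *\<^sub>R n x"
    have ph: "phi \<A> F \<xi> (\<psi> x) (frame (f x) e) = frame (f x) (?\<phi> e)" for e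
      using phi_frame[of F "\<psi> x" \<A> \<xi> "n x" e] by (simp add: F\<psi> fS x th m_frame[symmetric] unit)
    have dt: "frame (f x) d \<in> tangent_hyp \<A> F (\<psi> x)" using th_frame[OF x] d by simp
    have "A (\<psi> x) (frame (f x) d) \<in> tangent_hyp \<A> F (\<psi> x)"
      using so \<psi>(2)[OF x] dt by (simp add: shape_operator_on_def)
    then obtain s where As: "A (\<psi> x) (frame (f x) d) = frame (f x) s"
      using frame_coords[OF fS[OF x]] unfolding th[OF x] by (metis (no_types, lifting) mem_Collect_eq)
    have Ss: "S x d = \<kappa> *\<^sub>R s" by (simp add: S_def As coords_frame fS x)
    have "A (\<psi> x) (frame (f x) (?\<phi> d)) + frame (f x) (?\<phi> s) = 0"
      using anti[OF \<psi>(2)[OF x] dt] by (simp only: ph As)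
    then have "coords (f x) (A (\<psi> x) (frame (f x) (?\<phi> d)) + frame (f x) (?\<phi> s)) = coords (f x) 0"
      by (rule arg_cong)
    then have "coords (f x) (A (\<psi> x) (frame (f x) (?\<phi> d))) + ?\<phi> s = 0"
      by (simp only: bilinear_radd[OF bilinear_coords] bilinear_rzero[OF bilinear_coords] coords_frame[OF fS[OF x]])
    then have "\<kappa> *\<^sub>R (coords (f x) (A (\<psi> x) (frame (f x) (?\<phi> d))) + ?\<phi> s) = 0" by simp
    then show "S x (Jc d - (Jc d \<bullet> n x) *\<^sub>R n x) + (Jc (S x d) - (Jc (S x d) \<bullet> n x) *\<^sub>R n x) = 0"
      unfolding Ss by (simp add: S_def linear_scale[OF linear_Jc] scaleR_add_right scaleR_diff_right)
  qed
  show ?thesis using empty_domain by (simp add: \<Omega>_def)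
qed

section \<open>Nonexistence\<close>

theorem theorem1p3:
  fixes nabla :: "(quat2 \<Rightarrow> quat2) \<Rightarrow> (quat2 \<Rightarrow> quat2) \<Rightarrow> quat2 \<Rightarrow> quat2"
  assumes "levi_civita nabla"
  shows "\<not> (\<exists>(M :: 'm topology) (\<A> :: ('m, real^5) chart set) (F :: 'm \<Rightarrow> quat2).
      immersed_hypersurface M \<A> F \<and>
      (\<forall>x\<in>topspace M. \<exists>V \<xi> A. openin M V \<and> x \<in> V \<and>
         unit_normal_on \<A> F V \<xi> \<and>
         shape_operator_on nabla M \<A> F V \<xi> A \<and>
         (\<forall>y\<in>V. \<forall>w\<in>tangent_hyp \<A> F y.
            A y (phi \<A> F \<xi> y w) + phi \<A> F \<xi> y (A y w) = 0)))"
proof (intro notI, elim exE conjE)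
  fix M :: "'m topology" and \<A> :: "('m, real^5) chart set" and F :: "'m \<Rightarrow> quat2"
  assume imm: "immersed_hypersurface M \<A> F"
    and loc: "\<forall>x\<in>topspace M. \<exists>V \<xi> A. openin M V \<and> x \<in> V \<and>
         unit_normal_on \<A> F V \<xi> \<and> shape_operator_on nabla M \<A> F V \<xi> A \<and>
         (\<forall>y\<in>V. \<forall>w\<in>tangent_hyp \<A> F y. A y (phi \<A> F \<xi> y w) + phi \<A> F \<xi> y (A y w) = 0)"
  obtain x where x: "x \<in> topspace M" using imm unfolding immersed_hypersurface_def by blast
  obtain V \<xi> A where V: "openin M V" "x \<in> V" "unit_normal_on \<A> F V \<xi>"
    "shape_operator_on nabla M \<A> F V \<xi> A"
    "\<And>y w. y \<in> V \<Longrightarrow> w \<in> tangent_hyp \<A> F y \<Longrightarrow> A y (phi \<A> F \<xi> y w) + phi \<A> F \<xi> y (A y w) = 0"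
    using bspec[OF loc x] by blast
  have "smooth_manifold M \<A>" using imm by (simp add: immersed_hypersurface_def)
  then obtain U c where Uc: "(U, c) \<in> \<A>" "x \<in> U" using chart_around[OF _ x] by metis
  have "c ` (U \<inter> V) = {}" by (rule chart_domain_empty[OF assms imm V(1,3,4,5) Uc(1)])
  then show False using Uc(2) V(2) by blast
qed

end
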